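(* Let $0<c<1\le C<\infty$, let $f_n:[t_0,t_1]\to(0,\infty)$ ($n\in\mathbb{N}$) be a sequence of bounded, measurable functions, and let $Q_n\subset[t_0,t_1]$ be a sequence of countable dense subsets. Suppose that for every $n$ $$f_n(q)\le C\quad\forall q\in Q_n,\qquad f_n(x)\ge c\quad\forall x\in[t_0,t_1].$$ Then, for every $n$, $d_{f_n}$ satisfies the Lipschitz bound $$c\,d(p,q)\le d_{f_n}(p,q)\le\sqrt2\,C\,d(p,q)\quad\text{for all }p,q\in M,$$ and a subsequence of $d_{f_n}$ converges uniformly to a metric $d_\infty$ on $M$ which induces the same topology as the metrics $d_{f_n}$ of the sequence and satisfies $$c\,d(p,q)\le d_\infty(p,q)\le\sqrt2\,C\,d(p,q)\quad\text{for all }p,q\in M.$$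
   Context: Setting: $t_0<t_1$ are real numbers, $(\Sigma,\sigma)$ is a smooth, compact, connected Riemannian manifold with Riemannian distance function $d_\sigma$, and $M=[t_0,t_1]\times\Sigma$. A point $p\in M$ is written $p=(x(p),p_\Sigma)$ with $x(p)\in[t_0,t_1]$, $p_\Sigma\in\Sigma$. For a bounded, measurable $f:[t_0,t_1]\to(0,\infty)$ and a piecewise smooth curve $\gamma:[0,1]\to M$, $\gamma(t)=(x(t),\alpha(t))$, put $$L_f(\gamma)=\int_0^1\sqrt{x'(t)^2+f(x(t))^2\,\sigma(\alpha'(t),\alpha'(t))}\,dt,$$ $$d_f(p,q)=\inf\{L_f(\gamma):\gamma\text{ piecewise smooth},\ \gamma(0)=p,\ \gamma(1)=q\}.$$ The reference metric on $M$ is $d(p,q)=\sqrt{|x(q)-x(p)|^2+d_\sigma(p_\Sigma,q_\Sigma)^2}$ (equal to $d_f$ with $f\equiv1$). Metrics $d_j$ on $M$ converge uniformly to $d_0$ if $\sup_{p,q\in M}|d_j(p,q)-d_0(p,q)|\to0$. *)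

theory Defs
  imports "HOL-Analysis.Analysis"
begin

text \<open>Iterated directional derivatives, taken within \<open>S\<close>. The notion is meant for a
  finite-dimensional domain and for sets \<open>S\<close> on which derivatives within \<open>S\<close> are unique: below,
  \<open>S\<close> is an open set or a relatively open subset of a nondegenerate compact interval, where the
  derivatives at the end points are one-sided.\<close>

primrec Ck_on :: "nat \<Rightarrow> 'e::real_normed_vector set \<Rightarrow> ('e \<Rightarrow> 'f::real_normed_vector) \<Rightarrow> bool" where
  "Ck_on 0 S h \<longleftrightarrow> continuous_on S h"
| "Ck_on (Suc k) S h \<longleftrightarrow>
     (\<exists>h'. (\<forall>x\<in>S. (h has_derivative h' x) (at x within S)) \<and> (\<forall>v. Ck_on k S (\<lambda>x. h' x v)))"

definition smooth_on :: "'e::real_normed_vector set \<Rightarrow> ('e \<Rightarrow> 'f::real_normed_vector) \<Rightarrow> bool" where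
  "smooth_on S h \<longleftrightarrow> (\<forall>k. Ck_on k S h)"

text \<open>A chart is a pair of its domain and its coordinate map; the values of the map outside the
  domain are irrelevant.\<close>

type_synonym ('a, 'e) chart = "'a set \<times> ('a \<Rightarrow> 'e)"

definition is_chart :: "('a::topological_space, 'e::real_normed_vector) chart \<Rightarrow> bool" where
  "is_chart c \<longleftrightarrow> open (fst c) \<and> open (snd c ` fst c) \<and>
     (\<exists>\<psi>. homeomorphism (fst c) (snd c ` fst c) (snd c) \<psi>)"

definition chart_inv :: "('a, 'e) chart \<Rightarrow> 'e \<Rightarrow> 'a" where
  "chart_inv c = inv_into (fst c) (snd c)"

text \<open>A smooth atlas (without boundary) on the whole type \<open>'a\<close>, modelled on the
  finite-dimensional Euclidean space \<open>'e\<close>. Finite dimension is stated explicitly, instead of using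
  the class \<open>euclidean_space\<close>, because that class excludes dimension 0.\<close>

definition smooth_atlas ::
  "('a::{t2_space, second_countable_topology}, 'e::real_inner) chart set \<Rightarrow> bool" where
  "smooth_atlas A \<longleftrightarrow>
     (\<exists>B::'e set. finite B \<and> span B = UNIV) \<and>
     (\<forall>c\<in>A. is_chart c) \<and>
     (\<Union>c\<in>A. fst c) = UNIV \<and>
     (\<forall>c\<in>A. \<forall>d\<in>A. smooth_on (snd c ` (fst c \<inter> fst d)) (snd d \<circ> chart_inv c))"

text \<open>A Riemannian metric is given by its local representations: \<open>g c p u v\<close> is \<open>\<sigma>(X, Y)\<close> for the
  tangent vectors \<open>X\<close>, \<open>Y\<close> at \<open>p\<close> with components \<open>u\<close>, \<open>v\<close> in the chart \<open>c\<close>. The last clause is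
  the transformation law of a covariant 2-tensor.\<close>

definition riemannian_metric ::
  "('a::{t2_space, second_countable_topology}, 'e::real_inner) chart set \<Rightarrow>
   (('a, 'e) chart \<Rightarrow> 'a \<Rightarrow> 'e \<Rightarrow> 'e \<Rightarrow> real) \<Rightarrow> bool" where
  "riemannian_metric A g \<longleftrightarrow>
     (\<forall>c\<in>A. \<forall>p\<in>fst c. bilinear (g c p) \<and> (\<forall>u v. g c p u v = g c p v u) \<and>
        (\<forall>v. v \<noteq> 0 \<longrightarrow> g c p v v > 0)) \<and>
     (\<forall>c\<in>A. \<forall>u v. smooth_on (snd c ` fst c) (\<lambda>y. g c (chart_inv c y) u v)) \<and>
     (\<forall>c\<in>A. \<forall>d\<in>A. \<forall>p\<in>fst c \<inter> fst d. \<forall>T.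
        ((snd d \<circ> chart_inv c) has_derivative T) (at (snd c p)) \<longrightarrow>
        (\<forall>u v. g c p u v = g d p (T u) (T v)))"

definition smooth_curve_on ::
  "('a::topological_space, 'e::real_normed_vector) chart set \<Rightarrow> real set \<Rightarrow> (real \<Rightarrow> 'a) \<Rightarrow> bool" where
  "smooth_curve_on A I \<alpha> \<longleftrightarrow> continuous_on I \<alpha> \<and>
     (\<forall>c\<in>A. smooth_on {t \<in> I. \<alpha> t \<in> fst c} (snd c \<circ> \<alpha>))"

text \<open>Continuity on \<open>[0,1]\<close> is implied, since consecutive closed pieces share an end point.\<close>

definition piecewise_smooth ::
  "('a::topological_space, 'e::real_normed_vector) chart set \<Rightarrow> (real \<Rightarrow> 'a) \<Rightarrow> bool" where
  "piecewise_smooth A \<alpha> \<longleftrightarrow> (\<exists>(k::nat) s. s 0 = (0::real) \<and> s k = 1 \<and>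
     (\<forall>i<k. s i < s (Suc i) \<and> smooth_curve_on A {s i..s (Suc i)} \<alpha>))"

text \<open>\<open>\<sigma>(\<alpha>'(t), \<alpha>'(t))\<close>, computed in some chart around \<open>\<alpha> t\<close>; by the transformation law the choice
  does not matter. At the finitely many \<open>t\<close> where \<open>\<alpha>\<close> is not differentiable the value is
  arbitrary, which does not affect the integrals below.\<close>

definition speed_sq ::
  "('a::topological_space, 'e::real_normed_vector) chart set \<Rightarrow>
   (('a, 'e) chart \<Rightarrow> 'a \<Rightarrow> 'e \<Rightarrow> 'e \<Rightarrow> real) \<Rightarrow> (real \<Rightarrow> 'a) \<Rightarrow> real \<Rightarrow> real" where
  "speed_sq A g \<alpha> t =
     (let c = (SOME c. c \<in> A \<and> \<alpha> t \<in> fst c);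
          v = vector_derivative (snd c \<circ> \<alpha>) (at t)
      in g c (\<alpha> t) v v)"

definition riem_length ::
  "('a::topological_space, 'e::real_normed_vector) chart set \<Rightarrow>
   (('a, 'e) chart \<Rightarrow> 'a \<Rightarrow> 'e \<Rightarrow> 'e \<Rightarrow> real) \<Rightarrow> (real \<Rightarrow> 'a) \<Rightarrow> real" where
  "riem_length A g \<alpha> = (LINT t:{0..1}|lborel. sqrt (speed_sq A g \<alpha> t))"

definition riem_dist ::
  "('a::topological_space, 'e::real_normed_vector) chart set \<Rightarrow>
   (('a, 'e) chart \<Rightarrow> 'a \<Rightarrow> 'e \<Rightarrow> 'e \<Rightarrow> real) \<Rightarrow> 'a \<Rightarrow> 'a \<Rightarrow> real" where
  "riem_dist A g p q =
     Inf {riem_length A g \<alpha> | \<alpha>. piecewise_smooth A \<alpha> \<and> \<alpha> 0 = p \<and> \<alpha> 1 = q}"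

definition warped_space :: "real \<Rightarrow> real \<Rightarrow> (real \<times> 'a) set" where
  "warped_space t0 t1 = {t0..t1} \<times> UNIV"

text \<open>A curve in \<open>[t0,t1] \<times> \<Sigma>\<close> is piecewise smooth if both components are; the real line
  carries its standard one-chart atlas.\<close>

definition warped_curve ::
  "real \<Rightarrow> real \<Rightarrow> ('a::topological_space, 'e::real_normed_vector) chart set \<Rightarrow>
   (real \<Rightarrow> real \<times> 'a) \<Rightarrow> bool" where
  "warped_curve t0 t1 A \<gamma> \<longleftrightarrow> \<gamma> ` {0..1} \<subseteq> warped_space t0 t1 \<and>
     piecewise_smooth {(UNIV, \<lambda>x::real. x)} (fst \<circ> \<gamma>) \<and> piecewise_smooth A (snd \<circ> \<gamma>)"

definition warped_length ::
  "('a::topological_space, 'e::real_normed_vector) chart set \<Rightarrow>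
   (('a, 'e) chart \<Rightarrow> 'a \<Rightarrow> 'e \<Rightarrow> 'e \<Rightarrow> real) \<Rightarrow> (real \<Rightarrow> real) \<Rightarrow> (real \<Rightarrow> real \<times> 'a) \<Rightarrow> real" where
  "warped_length A g f \<gamma> =
     (LINT t:{0..1}|lborel.
        sqrt ((deriv (fst \<circ> \<gamma>) t)\<^sup>2 + (f (fst (\<gamma> t)))\<^sup>2 * speed_sq A g (snd \<circ> \<gamma>) t))"

text \<open>The value 0 outside the space only serves the convention of \<open>Metric_space\<close>, which requires
  nonnegativity and symmetry on the whole type.\<close>

definition warped_dist ::
  "real \<Rightarrow> real \<Rightarrow> ('a::topological_space, 'e::real_normed_vector) chart set \<Rightarrow>
   (('a, 'e) chart \<Rightarrow> 'a \<Rightarrow> 'e \<Rightarrow> 'e \<Rightarrow> real) \<Rightarrow> (real \<Rightarrow> real) \<Rightarrow>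
   real \<times> 'a \<Rightarrow> real \<times> 'a \<Rightarrow> real" where
  "warped_dist t0 t1 A g f p q =
     (if p \<in> warped_space t0 t1 \<and> q \<in> warped_space t0 t1
      then Inf {warped_length A g f \<gamma> | \<gamma>. warped_curve t0 t1 A \<gamma> \<and> \<gamma> 0 = p \<and> \<gamma> 1 = q}
      else 0)"

definition ref_dist ::
  "('a::topological_space, 'e::real_normed_vector) chart set \<Rightarrow>
   (('a, 'e) chart \<Rightarrow> 'a \<Rightarrow> 'e \<Rightarrow> 'e \<Rightarrow> real) \<Rightarrow> real \<times> 'a \<Rightarrow> real \<times> 'a \<Rightarrow> real" where
  "ref_dist A g p q = sqrt (\<bar>fst q - fst p\<bar>\<^sup>2 + (riem_dist A g (snd p) (snd q))\<^sup>2)"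

end

theory Submission
  imports Defs "HOL-Complex_Analysis.Great_Picard"
begin

text \<open>
  The lengths of curves are compared with the reference metric in both directions. From below, a
  curve in the warped product has speed at least \<open>c\<close> times its speed in the unwarped product
  (because \<open>f \<ge> c\<close> and \<open>c < 1\<close>), and the Cauchy-Schwarz inequality bounds the unwarped length
  by the distances of the two components (\<open>ref_dist_le_warped_dist\<close>). From above, one level \<open>r\<close> with
  \<open>f r \<le> C\<close> suffices: moving vertically to this level, horizontally along it, and vertically to the
  end point costs \<open>\<bar>x - r\<bar> + C d\<^sub>\<sigma> + \<bar>r - y\<bar>\<close>, and by density \<open>r\<close> may be taken arbitrarily close to
  the starting level (\<open>warped_dist_le_ref_dist\<close>). This is why bounds on a dense set are enough.

  The upper bound makes the distances equicontinuous with respect to the reference metric. The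
  latter is totally bounded because the manifold is compact, so an Arzela-Ascoli argument yields a
  uniformly convergent subsequence (\<open>uniformly_convergent_subsequence_of_dominated_metrics\<close>). The two
  bounds pass to the limit; the lower one shows that the limit separates points, and both together
  make all metrics bi-Lipschitz equivalent, so that they induce the same topology.

  What this uses from Riemannian geometry is derived from the definitions. The squared speed of a
  piecewise smooth curve is independent of the chart and extends continuously to the closed smooth
  pieces, so lengths are genuine integrals (\<open>speed_continuous_extension\<close>). In a coordinate ball the
  Riemannian norm is comparable to the norm of the model space (\<open>metric_comparison\<close>). Coordinate
  segments therefore show that nearby points have small distance and, with connectedness, that any
  two points are joined by a curve; conversely a curve that leaves a coordinate ball has a definite
  length, so that distinct points have positive distance (\<open>riem_dist_pos\<close>). That lengths are
  invariant under reversal and additive under concatenation gives symmetry and the triangle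
  inequality.\<close>

section \<open>Smooth maps and piecewise smooth curves\<close>

lemma Ck_on_cong:
  assumes "Ck_on k S h" and "\<And>x. x \<in> S \<Longrightarrow> h' x = h x"
  shows "Ck_on k S h'"
proof (cases k)
  case 0
  then show ?thesis using assms by (simp cong: continuous_on_cong)
next
  case (Suc j)
  with assms(1) obtain D where D: "\<And>x. x \<in> S \<Longrightarrow> (h has_derivative D x) (at x within S)"
    "\<And>v. Ck_on j S (\<lambda>x. D x v)" by auto
  have "(h' has_derivative D x) (at x within S)" if "x \<in> S" for x
    using has_derivative_transform[OF that _ D(1)[OF that]] assms(2) by blast
  then show ?thesis using Suc D(2) by auto
qed

text \<open>The derivative of \<open>t \<mapsto> h (p + L t)\<close> in the direction \<open>u\<close> is the derivative of \<open>h\<close> in the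
direction \<open>L u\<close>. Since \<open>Ck_on\<close> iterates directional derivatives, this one formula carries the
whole induction. Affine maps occur below both as reparametrisations of curves and as straight
segments in the image of a chart.\<close>

lemma Ck_on_affine:
  assumes "bounded_linear L" and "\<And>t. t \<in> T \<Longrightarrow> p + L t \<in> S"
  shows "Ck_on k S h \<Longrightarrow> Ck_on k T (\<lambda>t. h (p + L t))"
proof (induction k arbitrary: h)
  case 0
  have "continuous_on T (\<lambda>t. p + L t)"
    by (intro continuous_intros linear_continuous_on assms(1))
  then show ?case
    using 0 assms(2) by (auto intro: continuous_on_compose2[of S h])
next
  case (Suc k)
  then obtain D where D: "\<And>x. x \<in> S \<Longrightarrow> (h has_derivative D x) (at x within S)"
    "\<And>v. Ck_on k S (\<lambda>x. D x v)" by auto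
  have "((\<lambda>t. h (p + L t)) has_derivative (\<lambda>u. D (p + L t) (L u))) (at t within T)"
    if "t \<in> T" for t
  proof (rule has_derivative_in_compose[where f = "\<lambda>t. p + L t"])
    show "((\<lambda>t. p + L t) has_derivative L) (at t within T)"
      by (auto intro!: derivative_eq_intros bounded_linear_imp_has_derivative assms(1))
    show "(h has_derivative D (p + L t)) (at (p + L t) within (\<lambda>t. p + L t) ` T)"
      by (rule has_derivative_subset[OF D(1)]) (use that assms(2) in auto)
  qed
  moreover have "Ck_on k T (\<lambda>t. D (p + L t) (L u))" for u
    using Suc.IH[OF D(2)[of "L u"]] .
  ultimately show ?case by (auto intro!: exI[of _ "\<lambda>t u. D (p + L t) (L u)"])
qed

lemma smooth_on_affine:
  assumes "smooth_on S h" "bounded_linear L" and "\<And>t. t \<in> T \<Longrightarrow> p + L t \<in> S"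
  shows "smooth_on T (\<lambda>t. h (p + L t))"
  using assms Ck_on_affine[OF assms(2,3)] unfolding smooth_on_def by blast

lemma smooth_on_cong:
  "smooth_on S h \<Longrightarrow> (\<And>x. x \<in> S \<Longrightarrow> h' x = h x) \<Longrightarrow> smooth_on S h'"
  unfolding smooth_on_def using Ck_on_cong by blast

lemma smooth_on_const: "smooth_on S (\<lambda>_. a)"
proof -
  have "Ck_on k S (\<lambda>_. a)" for k and a :: 'b
    by (induction k arbitrary: a) (auto intro!: exI[of _ "\<lambda>_ _. 0"])
  then show ?thesis by (simp add: smooth_on_def)
qed

lemma smooth_on_ident: "smooth_on S (\<lambda>x. x)"
proof -
  have "Ck_on k S (\<lambda>x. x)" for k
    using smooth_on_const[of S] unfolding smooth_on_def
    by (cases k) (auto intro!: exI[of _ "\<lambda>_ v. v"])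
  then show ?thesis by (simp add: smooth_on_def)
qed

lemma smooth_on_imp_continuous_on: "smooth_on S h \<Longrightarrow> continuous_on S h"
  unfolding smooth_on_def by (metis Ck_on.simps(1))

lemma smooth_on_imp_derivative:
  assumes "smooth_on S h"
  shows "\<exists>D. (\<forall>x\<in>S. (h has_derivative D x) (at x within S)) \<and> (\<forall>v. continuous_on S (\<lambda>x. D x v))"
proof -
  have "Ck_on (Suc 0) S h" using assms by (simp add: smooth_on_def del: Ck_on.simps)
  then show ?thesis by simp
qed

lemma smooth_curve_on_affine:
  assumes "smooth_curve_on A I \<alpha>" and sub: "\<And>t. t \<in> J \<Longrightarrow> c + m * t \<in> I"
  shows "smooth_curve_on A J (\<lambda>t. \<alpha> (c + m * t))"
  unfolding smooth_curve_on_def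
proof (intro conjI ballI)
  show "continuous_on J (\<lambda>t. \<alpha> (c + m * t))"
    using assms unfolding smooth_curve_on_def
    by (auto intro!: continuous_on_compose2[of I \<alpha>] continuous_intros)
  fix ch assume "ch \<in> A"
  then have "smooth_on {t \<in> I. \<alpha> t \<in> fst ch} (snd ch \<circ> \<alpha>)"
    using assms(1) by (auto simp: smooth_curve_on_def)
  from smooth_on_affine[OF this bounded_linear_mult_right[of m],
      of "{t \<in> J. \<alpha> (c + m * t) \<in> fst ch}" c]
  show "smooth_on {t \<in> J. \<alpha> (c + m * t) \<in> fst ch} (snd ch \<circ> (\<lambda>t. \<alpha> (c + m * t)))"
    using sub by (simp add: o_def)
qed

lemma smooth_curve_on_cong:
  assumes "smooth_curve_on A I \<alpha>" and eq: "\<And>t. t \<in> I \<Longrightarrow> \<beta> t = \<alpha> t"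
  shows "smooth_curve_on A I \<beta>"
  unfolding smooth_curve_on_def
proof (intro conjI ballI)
  show "continuous_on I \<beta>"
    using assms by (simp add: smooth_curve_on_def cong: continuous_on_cong)
  fix ch assume "ch \<in> A"
  then have "smooth_on {t \<in> I. \<alpha> t \<in> fst ch} (snd ch \<circ> \<alpha>)"
    using assms(1) by (auto simp: smooth_curve_on_def)
  moreover have "{t \<in> I. \<alpha> t \<in> fst ch} = {t \<in> I. \<beta> t \<in> fst ch}" using eq by auto
  ultimately show "smooth_on {t \<in> I. \<beta> t \<in> fst ch} (snd ch \<circ> \<beta>)"
    by (metis (mono_tags, lifting) smooth_on_cong comp_apply eq mem_Collect_eq)
qed

text \<open>Piecewise smoothness on an arbitrary interval, generated by concatenation. A property that holds
on smooth pieces and passes to concatenations then follows by rule induction, without any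
bookkeeping about partitions.\<close>

inductive psmooth ::
  "('a::topological_space, 'e::real_normed_vector) chart set \<Rightarrow> real \<Rightarrow> real \<Rightarrow> (real \<Rightarrow> 'a) \<Rightarrow> bool"
  for A where
  single: "a < b \<Longrightarrow> smooth_curve_on A {a..b} \<alpha> \<Longrightarrow> psmooth A a b \<alpha>"
| join: "psmooth A a m \<alpha> \<Longrightarrow> psmooth A m b \<alpha> \<Longrightarrow> psmooth A a b \<alpha>"

lemma psmooth_less: "psmooth A a b \<alpha> \<Longrightarrow> a < b"
  by (induction rule: psmooth.induct) auto

lemma psmooth_imp_partition:
  "psmooth A a b \<alpha> \<Longrightarrow> \<exists>(k::nat) s. s 0 = a \<and> s k = b \<and>
     (\<forall>i<k. s i < s (Suc i) \<and> smooth_curve_on A {s i..s (Suc i)} \<alpha>)"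
proof (induction rule: psmooth.induct)
  case (single a b \<alpha>)
  then show ?case by (intro exI[of _ 1] exI[of _ "\<lambda>i. if i = 0 then a else b"]) auto
next
  case (join a m \<alpha> b)
  obtain k s where s: "s 0 = a" "s (k::nat) = m"
    "\<forall>i<k. s i < s (Suc i) \<and> smooth_curve_on A {s i..s (Suc i)} \<alpha>" using join.IH(1) by blast
  obtain l r where r: "r 0 = m" "r (l::nat) = b"
    "\<forall>i<l. r i < r (Suc i) \<and> smooth_curve_on A {r i..r (Suc i)} \<alpha>" using join.IH(2) by blast
  define u where "u i = (if i \<le> k then s i else r (i - k))" for i
  have u2: "u i = r (i - k)" if "i \<ge> k" for i
    using that s(2) r(1) by (auto simp: u_def)
  have "u i < u (Suc i) \<and> smooth_curve_on A {u i..u (Suc i)} \<alpha>" if "i < k + l" for i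
  proof (cases "i < k")
    case True
    then show ?thesis using s(3) by (simp add: u_def)
  next
    case False
    then have "i - k < l" "u i = r (i - k)" "u (Suc i) = r (Suc (i - k))"
      using that u2 by (auto simp: Suc_diff_le)
    then show ?thesis using r(3) by simp
  qed
  moreover have "u 0 = a" "u (k + l) = b" using s r u2 by (auto simp: u_def)
  ultimately show ?case by blast
qed

lemma piecewise_smooth_iff: "piecewise_smooth A \<alpha> \<longleftrightarrow> psmooth A 0 1 \<alpha>"
proof
  assume "piecewise_smooth A \<alpha>"
  then obtain k s where s: "s 0 = (0::real)" "s (k::nat) = 1"
    "\<And>i. i < k \<Longrightarrow> s i < s (Suc i) \<and> smooth_curve_on A {s i..s (Suc i)} \<alpha>"
    unfolding piecewise_smooth_def by blast
  have "Suc j \<le> k \<Longrightarrow> psmooth A (s 0) (s (Suc j)) \<alpha>" for j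
  proof (induction j)
    case 0
    then show ?case using s(3)[of 0] by (auto intro: psmooth.single)
  next
    case (Suc j)
    then show ?case using s(3)[of "Suc j"] by (auto intro: psmooth.single psmooth.join)
  qed
  moreover have "k \<noteq> 0" using s by (metis zero_neq_one)
  ultimately show "psmooth A 0 1 \<alpha>" using s(1,2) by (metis Suc_pred' le_refl neq0_conv)
next
  assume "psmooth A 0 1 \<alpha>"
  then show "piecewise_smooth A \<alpha>"
    unfolding piecewise_smooth_def by (rule psmooth_imp_partition)
qed

lemma psmooth_cong:
  "psmooth A a b \<alpha> \<Longrightarrow> (\<And>t. t \<in> {a..b} \<Longrightarrow> \<beta> t = \<alpha> t) \<Longrightarrow> psmooth A a b \<beta>"
proof (induction rule: psmooth.induct)
  case (single a b \<alpha>)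
  then show ?case by (meson psmooth.single smooth_curve_on_cong)
next
  case (join a m \<alpha> b)
  have "psmooth A a m \<beta>" "psmooth A m b \<beta>"
    using join.IH join.prems psmooth_less[OF join.hyps(1)] psmooth_less[OF join.hyps(2)] by auto
  then show ?case by (rule psmooth.join)
qed

lemma psmooth_affine:
  assumes "0 < m"
  shows "psmooth A a b \<alpha> \<Longrightarrow> psmooth A ((a - c) / m) ((b - c) / m) (\<lambda>t. \<alpha> (c + m * t))"
proof (induction rule: psmooth.induct)
  case (single a b \<alpha>)
  show ?case
  proof (rule psmooth.single)
    show "(a - c) / m < (b - c) / m"
      using single.hyps assms by (simp add: divide_strict_right_mono)
    show "smooth_curve_on A {(a - c) / m..(b - c) / m} (\<lambda>t. \<alpha> (c + m * t))"
      by (rule smooth_curve_on_affine[OF single.hyps(2)]) (use assms in \<open>auto simp: field_simps\<close>)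
  qed
qed (rule psmooth.join)

lemma psmooth_reverse:
  "psmooth A a b \<alpha> \<Longrightarrow> psmooth A (c - b) (c - a) (\<lambda>t. \<alpha> (c - t))"
proof (induction rule: psmooth.induct)
  case (single a b \<alpha>)
  show ?case
  proof (rule psmooth.single)
    show "smooth_curve_on A {c - b..c - a} (\<lambda>t. \<alpha> (c - t))"
      using smooth_curve_on_affine[OF single.hyps(2), of "{c - b..c - a}" c "-1"] by auto
  qed (use single in simp)
qed (rule psmooth.join)

lemma psmooth_imp_continuous_on: "psmooth A a b \<alpha> \<Longrightarrow> continuous_on {a..b} \<alpha>"
proof (induction rule: psmooth.induct)
  case (single a b \<alpha>)
  then show ?case by (simp add: smooth_curve_on_def)
next
  case (join a m \<alpha> b)
  then have "{a..b} = {a..m} \<union> {m..b}"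
    using psmooth_less[OF join.hyps(1)] psmooth_less[OF join.hyps(2)] by auto
  then show ?case using join.IH by (simp add: continuous_on_closed_Un)
qed

definition concat_curve :: "(real \<Rightarrow> 'b) \<Rightarrow> (real \<Rightarrow> 'b) \<Rightarrow> real \<Rightarrow> 'b" where
  "concat_curve \<alpha> \<beta> t = (if t \<le> 1/2 then \<alpha> (2 * t) else \<beta> (2 * t - 1))"

lemma piecewise_smooth_concat:
  assumes "piecewise_smooth A \<alpha>" "piecewise_smooth A \<beta>" "\<alpha> 1 = \<beta> 0"
  shows "piecewise_smooth A (concat_curve \<alpha> \<beta>)"
proof -
  have "psmooth A 0 (1/2) (concat_curve \<alpha> \<beta>)"
    by (rule psmooth_cong[OF psmooth_affine[of 2 A 0 1 \<alpha> 0, simplified]])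
       (use assms(1) in \<open>auto simp: piecewise_smooth_iff concat_curve_def\<close>)
  moreover have "psmooth A (1/2) 1 (concat_curve \<alpha> \<beta>)"
  proof (rule psmooth_cong)
    show "psmooth A (1/2) 1 (\<lambda>t. \<beta> (-1 + 2 * t))"
      using psmooth_affine[of 2 A 0 1 \<beta> "-1"] assms(2) by (simp add: piecewise_smooth_iff)
    show "concat_curve \<alpha> \<beta> t = \<beta> (-1 + 2 * t)" if "t \<in> {1/2..1}" for t
    proof (cases "t \<le> 1/2")
      case True
      then have "2 * t = 1" "-1 + 2 * t = 0" using that by auto
      then show ?thesis using True assms(3) by (simp add: concat_curve_def)
    qed (simp add: concat_curve_def)
  qed
  ultimately show ?thesis by (auto simp: piecewise_smooth_iff intro: psmooth.join)
qed

lemma piecewise_smooth_reverse: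
  "piecewise_smooth A \<alpha> \<Longrightarrow> piecewise_smooth A (\<lambda>t. \<alpha> (1 - t))"
  using psmooth_reverse[of A 0 1 \<alpha> 1] by (simp add: piecewise_smooth_iff)

lemma smooth_curve_on_const: "smooth_curve_on A I (\<lambda>_. p)"
  by (auto simp: smooth_curve_on_def o_def intro: smooth_on_const)

lemma piecewise_smooth_single:
  "smooth_curve_on A {0..1} \<alpha> \<Longrightarrow> piecewise_smooth A \<alpha>"
  unfolding piecewise_smooth_iff by (rule psmooth.single) auto

section \<open>Finite-dimensional inner product spaces\<close>

text \<open>The nonzero vectors of an orthogonal spanning set are normalised; pairing a linear combination
with one of them reads off its coefficient. The expansion is oriented so that it can be used as a
rewrite rule.\<close>

lemma ex_orthonormal_basis:
  fixes B :: "'e::real_inner set"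
  assumes "finite B" "span B = UNIV"
  shows "\<exists>C::'e set. finite C \<and> (\<forall>u\<in>C. norm u = 1) \<and> (\<forall>v. (\<Sum>u\<in>C. (v \<bullet> u) *\<^sub>R u) = v)"
proof -
  obtain D where D: "finite D" "span D = (UNIV :: 'e set)" "pairwise orthogonal D"
    using basis_orthogonal[OF assms(1)] assms(2) by auto
  have exp: "v = (\<Sum>u\<in>D - {0}. (v \<bullet> sgn u) *\<^sub>R sgn u)" for v :: 'e
  proof -
    have "v \<in> span (D - {0})" using D(2) by (simp add: span_delete_0)
    then obtain a where a: "v = (\<Sum>w\<in>D - {0}. a w *\<^sub>R w)"
      using span_finite[of "D - {0}"] D(1) by auto
    have "(v \<bullet> sgn u) *\<^sub>R sgn u = a u *\<^sub>R u" if u: "u \<in> D - {0}" for u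
    proof -
      have "v \<bullet> u = (\<Sum>w\<in>D - {0}. a w * (w \<bullet> u))"
        by (simp add: a inner_sum_left)
      also have "\<dots> = (\<Sum>w\<in>D - {0}. if w = u then a u * (u \<bullet> u) else 0)"
        using D(3) u by (intro sum.cong) (auto simp: pairwise_def orthogonal_def)
      also have "\<dots> = a u * (u \<bullet> u)" using u D(1) by simp
      finally have "v \<bullet> u = a u * (norm u * norm u)"
        by (simp add: dot_square_norm power2_eq_square)
      then show ?thesis using u by (simp add: sgn_div_norm field_simps)
    qed
    then show ?thesis using a sum.cong[of "D - {0}" "D - {0}"] by (metis (no_types, lifting))
  qed
  have inj: "inj_on sgn (D - {0})"
  proof (rule inj_onI, rule ccontr)
    fix u w assume uw: "u \<in> D - {0}" "w \<in> D - {0}" "sgn u = sgn w" "u \<noteq> w"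
    then have "u \<bullet> w = 0" using D(3) by (auto simp: pairwise_def orthogonal_def)
    then have "sgn u \<bullet> sgn w = 0" by (simp add: sgn_div_norm)
    then show False using uw by (simp add: sgn_zero_iff)
  qed
  show ?thesis
  proof (intro exI conjI ballI allI)
    show "norm u = 1" if "u \<in> sgn ` (D - {0})" for u
    proof -
      from that obtain x where "x \<in> D - {0}" "u = sgn x" by (elim imageE)
      then show ?thesis by (simp add: norm_sgn)
    qed
    show "finite (sgn ` (D - {0}))" using D(1) by simp
    show "(\<Sum>u\<in>sgn ` (D - {0}). (v \<bullet> u) *\<^sub>R u) = v" for v
      by (subst sum.reindex[OF inj]) (simp only: o_def exp[symmetric])
  qed
qed

text \<open>In an orthonormal basis the coordinates of a vector of \<open>cball 0 r\<close> lie in \<open>{-r..r}\<close>, so the ball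
is a closed subset of a continuous image of a cube. That image is built up by adding one basis
vector at a time.\<close>

lemma compact_cball_finite_span:
  fixes y :: "'e::real_inner"
  assumes "finite B" "span B = (UNIV :: 'e set)"
  shows "compact (cball y r)"
proof -
  obtain C :: "'e set" where C: "finite C" "\<And>u. u \<in> C \<Longrightarrow> norm u = 1"
    "\<And>v. (\<Sum>u\<in>C. (v \<bullet> u) *\<^sub>R u) = v"
    using ex_orthonormal_basis[OF assms] by blast
  have "\<exists>K. compact K \<and> (\<forall>a. (\<forall>u\<in>C. \<bar>a u\<bar> \<le> r) \<longrightarrow> (\<Sum>u\<in>C. a u *\<^sub>R u) \<in> K)"
    using C(1)
  proof (induction C)
    case empty
    then show ?case by (intro exI[of _ "{0}"]) auto
  next
    case (insert w C)
    then obtain K where K: "compact K"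
      "\<And>a. (\<forall>u\<in>C. \<bar>a u\<bar> \<le> r) \<Longrightarrow> (\<Sum>u\<in>C. a u *\<^sub>R u) \<in> K" by blast
    show ?case
    proof (intro exI conjI allI impI)
      show "compact ((\<lambda>(s, x). s *\<^sub>R w + x) ` ({-r..r} \<times> K))"
        by (intro compact_continuous_image compact_Times K(1) compact_Icc)
           (auto simp: case_prod_beta intro!: continuous_intros)
      fix a :: "'e \<Rightarrow> real" assume "\<forall>u\<in>insert w C. \<bar>a u\<bar> \<le> r"
      then show "(\<Sum>u\<in>insert w C. a u *\<^sub>R u) \<in> (\<lambda>(s, x). s *\<^sub>R w + x) ` ({-r..r} \<times> K)"
        using insert.hyps K(2)[of a] by (auto intro!: image_eqI[of _ _ "(a w, \<Sum>u\<in>C. a u *\<^sub>R u)"])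
    qed
  qed
  then obtain K where K: "compact K"
    "\<And>a. (\<forall>u\<in>C. \<bar>a u\<bar> \<le> r) \<Longrightarrow> (\<Sum>u\<in>C. a u *\<^sub>R u) \<in> K" by blast
  have "v \<in> K" if "v \<in> cball 0 r" for v
  proof -
    have "\<bar>v \<bullet> u\<bar> \<le> r" if "u \<in> C" for u
      using Cauchy_Schwarz_ineq2[of v u] C(2)[OF that] \<open>v \<in> cball 0 r\<close> by simp
    then have "(\<Sum>u\<in>C. (v \<bullet> u) *\<^sub>R u) \<in> K" by (intro K(2)) simp
    then show ?thesis by (simp only: C(3))
  qed
  then have "K \<inter> cball 0 r = cball 0 r" by blast
  then have "compact (cball (0::'e) r)"
    using compact_Int_closed[OF K(1) closed_cball[of 0 r]] by simp
  then show ?thesis using compact_translation[of "cball 0 r" y] by simp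
qed

section \<open>Measurable functions bounded off a finite set\<close>

text \<open>Measurable, and bounded apart from finitely many points. This is the regularity of the speed of a
piecewise smooth curve, whose values at the break points are arbitrary. It survives the algebraic
operations that occur in the length functional and implies integrability, so that none of the
integrals below takes the default value of a divergent Bochner integral.\<close>

definition essbdd_on :: "real \<Rightarrow> real \<Rightarrow> (real \<Rightarrow> real) \<Rightarrow> bool" where
  "essbdd_on a b h \<longleftrightarrow> h \<in> borel_measurable (restrict_space borel {a..b}) \<and>
     (\<exists>F B. finite F \<and> (\<forall>t\<in>{a..b} - F. \<bar>h t\<bar> \<le> B))"

lemma essbdd_on_continuous_inside:
  assumes "continuous_on {a..b} k" "\<And>t. t \<in> {a<..<b} \<Longrightarrow> h t = k t"
  shows "essbdd_on a b h"
proof -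
  have k: "k \<in> borel_measurable (restrict_space borel {a..b})"
    using assms(1) by (rule borel_measurable_continuous_on_restrict)
  have "h \<in> borel_measurable (restrict_space borel {a..b})"
  proof (rule measurable_discrete_difference[OF k, of "{a, b} \<inter> {a..b}"])
    show "{x} \<in> sets (restrict_space borel {a..b})" if "x \<in> {a, b} \<inter> {a..b}" for x
      using that by (auto simp: sets_restrict_space image_iff intro!: bexI[of _ "{x}"])
  qed (use assms(2) in \<open>auto simp: space_restrict_space\<close>)
  moreover have "\<exists>B. \<forall>t\<in>{a..b}. \<bar>k t\<bar> \<le> B"
    using compact_imp_bounded[OF compact_continuous_image[OF assms(1)]]
    by (auto simp: bounded_iff)
  then obtain B where "\<forall>t\<in>{a..b}. \<bar>k t\<bar> \<le> B" by blast
  then have "\<forall>t\<in>{a..b} - {a, b}. \<bar>h t\<bar> \<le> B" using assms(2) by auto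
  ultimately show ?thesis
    unfolding essbdd_on_def by (meson finite.emptyI finite_insert)
qed

lemma essbdd_on_join:
  assumes "essbdd_on a m h" "essbdd_on m b h" "a \<le> m" "m \<le> b"
  shows "essbdd_on a b h"
proof -
  obtain F B where 1: "finite F" "\<forall>t\<in>{a..m} - F. \<bar>h t\<bar> \<le> B"
    using assms(1) unfolding essbdd_on_def by blast
  obtain F' B' where 2: "finite F'" "\<forall>t\<in>{m..b} - F'. \<bar>h t\<bar> \<le> B'"
    using assms(2) unfolding essbdd_on_def by blast
  have "\<forall>t\<in>{a..b} - (F \<union> F'). \<bar>h t\<bar> \<le> max B B'"
  proof
    fix t assume t: "t \<in> {a..b} - (F \<union> F')"
    show "\<bar>h t\<bar> \<le> max B B'"
    proof (cases "t \<le> m")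
      case True
      then have "\<bar>h t\<bar> \<le> B" using 1 t by auto
      then show ?thesis by simp
    next
      case False
      then have "\<bar>h t\<bar> \<le> B'" using 2 t by auto
      then show ?thesis by simp
    qed
  qed
  moreover have "h \<in> borel_measurable (restrict_space borel {a..b})"
  proof -
    \<comment> \<open>The half-open interval keeps the common end point \<open>m\<close> from being counted twice.\<close>
    have "(\<lambda>t. indicator {a..m} t * h t) \<in> borel_measurable borel"
      "(\<lambda>t. indicator {m<..b} t * (indicator {m..b} t * h t)) \<in> borel_measurable borel"
      using assms(1,2)
      by (auto simp: essbdd_on_def borel_measurable_restrict_space_iff
          intro!: borel_measurable_times)
    then have "(\<lambda>t. indicator {a..m} t * h t + indicator {m<..b} t * (indicator {m..b} t * h t))
        \<in> borel_measurable borel" by (rule borel_measurable_add)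
    moreover have "indicator {a..m} t * h t + indicator {m<..b} t * (indicator {m..b} t * h t)
        = indicator {a..b} t * h t" for t
      using assms(3,4) by (auto simp: indicator_def)
    ultimately show ?thesis by (simp add: borel_measurable_restrict_space_iff)
  qed
  ultimately show ?thesis
    using 1(1) 2(1) unfolding essbdd_on_def by (metis finite_Un)
qed

lemma essbdd_on_set_integrable:
  assumes "essbdd_on a b h"
  shows "set_integrable lborel {a..b} h"
proof -
  obtain F B where F: "finite F" "\<And>t. t \<in> {a..b} - F \<Longrightarrow> \<bar>h t\<bar> \<le> B"
    using assms unfolding essbdd_on_def by blast
  have meas: "(\<lambda>t. indicator {a..b} t *\<^sub>R h t) \<in> borel_measurable lborel"
    using assms by (simp add: essbdd_on_def borel_measurable_restrict_space_iff)
  have "AE t in lborel. t \<notin> F"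
    using AE_lborel_singleton F(1) by (simp add: AE_finite_all AE_not_in finite_imp_null_set_lborel)
  then have "AE t in lborel. norm (indicator {a..b} t *\<^sub>R h t) \<le> norm (indicator {a..b} t *\<^sub>R B)"
    by eventually_elim (use F(2) in \<open>force simp: indicator_def\<close>)
  moreover have "integrable lborel (\<lambda>t. indicator {a..b} t *\<^sub>R B)"
    by (intro integrable_scaleR_left integrable_real_indicator) (auto simp: emeasure_lborel_Icc_eq)
  ultimately show ?thesis
    unfolding set_integrable_def using Bochner_Integration.integrable_bound meas by blast
qed

lemma has_integral_le_off_finite:
  fixes h k :: "real \<Rightarrow> real"
  assumes "(h has_integral i) S" "(k has_integral j) S" "finite F" "\<And>t. t \<in> S - F \<Longrightarrow> h t \<le> k t"
  shows "i \<le> j"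
proof -
  have "((\<lambda>t. if t \<in> F then k t else h t) has_integral i) S"
    by (rule has_integral_spike_finite[OF assms(3) _ assms(1)]) auto
  then show ?thesis by (rule has_integral_le[OF _ assms(2)]) (use assms(4) in auto)
qed

lemma essbdd_on_has_integral:
  assumes "essbdd_on a b h"
  shows "(h has_integral (LINT t:{a..b}|lborel. h t)) {a..b}"
  using set_borel_integral_eq_integral[OF essbdd_on_set_integrable[OF assms]]
  by (metis integrable_integral)

lemma essbdd_on_cong_finite:
  assumes "essbdd_on a b h" "finite F" "\<And>t. t \<in> {a..b} - F \<Longrightarrow> k t = h t"
  shows "essbdd_on a b k"
proof -
  obtain G B where G: "finite G" "\<forall>t\<in>{a..b} - G. \<bar>h t\<bar> \<le> B"
    and h: "h \<in> borel_measurable (restrict_space borel {a..b})"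
    using assms(1) unfolding essbdd_on_def by blast
  have "k \<in> borel_measurable (restrict_space borel {a..b})"
  proof (rule measurable_discrete_difference[OF h, of "F \<inter> {a..b}"])
    show "countable (F \<inter> {a..b})" using assms(2) by (simp add: countable_finite)
    show "{x} \<in> sets (restrict_space borel {a..b})" if "x \<in> F \<inter> {a..b}" for x
      using that by (auto simp: sets_restrict_space image_iff intro!: bexI[of _ "{x}"])
  qed (use assms(3) in \<open>auto simp: space_restrict_space\<close>)
  moreover have "\<forall>t\<in>{a..b} - (F \<union> G). \<bar>k t\<bar> \<le> B" using G(2) assms(3) by auto
  ultimately show ?thesis
    unfolding essbdd_on_def using assms(2) G(1) by (meson finite_UnI)
qed

lemma essbdd_on_compose2:
  assumes h: "essbdd_on a b h" and k: "essbdd_on a b k"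
    and "(\<lambda>t. \<phi> (h t) (k t)) \<in> borel_measurable (restrict_space borel {a..b})"
    and bound: "\<And>B. \<exists>B'. \<forall>x y. \<bar>x\<bar> \<le> B \<and> \<bar>y\<bar> \<le> B \<longrightarrow> \<bar>\<phi> x y :: real\<bar> \<le> B'"
  shows "essbdd_on a b (\<lambda>t. \<phi> (h t) (k t))"
proof -
  obtain F B where F: "finite F" "\<And>t. t \<in> {a..b} - F \<Longrightarrow> \<bar>h t\<bar> \<le> B"
    using h unfolding essbdd_on_def by blast
  obtain G D where G: "finite G" "\<And>t. t \<in> {a..b} - G \<Longrightarrow> \<bar>k t\<bar> \<le> D"
    using k unfolding essbdd_on_def by blast
  obtain B' where B': "\<And>x y. \<bar>x\<bar> \<le> max B D \<Longrightarrow> \<bar>y\<bar> \<le> max B D \<Longrightarrow> \<bar>\<phi> x y\<bar> \<le> B'"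
    using bound[of "max B D"] by auto
  have "\<bar>\<phi> (h t) (k t)\<bar> \<le> B'" if "t \<in> {a..b} - (F \<union> G)" for t
    by (rule B') (use F(2)[of t] G(2)[of t] that in auto)
  then show ?thesis
    unfolding essbdd_on_def using assms(3) F(1) G(1) by (meson finite_UnI)
qed

lemma essbdd_on_measurable: "essbdd_on a b h \<Longrightarrow> h \<in> borel_measurable (restrict_space borel {a..b})"
  by (simp add: essbdd_on_def)

lemma essbdd_on_add:
  assumes "essbdd_on a b h" "essbdd_on a b k"
  shows "essbdd_on a b (\<lambda>t. h t + k t)"
proof (rule essbdd_on_compose2[OF assms])
  show "(\<lambda>t. h t + k t) \<in> borel_measurable (restrict_space borel {a..b})"
    using assms by (intro borel_measurable_add essbdd_on_measurable)
  show "\<exists>B'. \<forall>x y. \<bar>x\<bar> \<le> B \<and> \<bar>y\<bar> \<le> B \<longrightarrow> \<bar>x + y\<bar> \<le> B'" for B :: real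
    by (intro exI[of _ "B + B"]) auto
qed

lemma essbdd_on_mult:
  assumes "essbdd_on a b h" "essbdd_on a b k"
  shows "essbdd_on a b (\<lambda>t. h t * k t)"
proof (rule essbdd_on_compose2[OF assms])
  show "(\<lambda>t. h t * k t) \<in> borel_measurable (restrict_space borel {a..b})"
    using assms by (intro borel_measurable_times essbdd_on_measurable)
  show "\<exists>B'. \<forall>x y. \<bar>x\<bar> \<le> B \<and> \<bar>y\<bar> \<le> B \<longrightarrow> \<bar>x * y\<bar> \<le> B'" for B :: real
    by (intro exI[of _ "B * B"]) (auto simp: abs_mult intro!: mult_mono)
qed

lemma essbdd_on_sqrt:
  assumes "essbdd_on a b h"
  shows "essbdd_on a b (\<lambda>t. sqrt (h t))"
proof (rule essbdd_on_compose2[OF assms assms, where \<phi> = "\<lambda>x _. sqrt x"])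
  show "(\<lambda>t. sqrt (h t)) \<in> borel_measurable (restrict_space borel {a..b})"
    using measurable_compose[OF essbdd_on_measurable[OF assms] borel_measurable_sqrt] .
  show "\<exists>B'. \<forall>x y. \<bar>x\<bar> \<le> B \<and> \<bar>y\<bar> \<le> B \<longrightarrow> \<bar>sqrt x\<bar> \<le> B'" for B :: real
    by (intro exI[of _ "sqrt B"]) (auto simp flip: real_sqrt_abs2 simp: abs_if real_sqrt_minus)
qed

section \<open>The speed of curves in a Riemannian manifold\<close>

locale riemannian =
  fixes A :: "('a::{t2_space, second_countable_topology}, 'e::real_inner) chart set"
    and g :: "('a, 'e) chart \<Rightarrow> 'a \<Rightarrow> 'e \<Rightarrow> 'e \<Rightarrow> real"
  assumes atlas: "smooth_atlas A" and metric: "riemannian_metric A g"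
begin

lemma
  assumes "c \<in> A"
  shows open_chart_domain: "open (fst c)" and open_chart_image: "open (snd c ` fst c)"
    and continuous_on_chart: "continuous_on (fst c) (snd c)"
    and continuous_on_chart_inv: "continuous_on (snd c ` fst c) (chart_inv c)"
    and chart_inv_chart: "\<And>p. p \<in> fst c \<Longrightarrow> chart_inv c (snd c p) = p"
    and chart_chart_inv: "\<And>y. y \<in> snd c ` fst c \<Longrightarrow> snd c (chart_inv c y) = y"
    and chart_inv_in: "\<And>y. y \<in> snd c ` fst c \<Longrightarrow> chart_inv c y \<in> fst c"
proof -
  have c: "is_chart c" using atlas assms by (auto simp: smooth_atlas_def)
  then obtain \<psi> where \<psi>: "homeomorphism (fst c) (snd c ` fst c) (snd c) \<psi>"
    by (auto simp: is_chart_def)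
  show "open (fst c)" "open (snd c ` fst c)" using c by (auto simp: is_chart_def)
  show "continuous_on (fst c) (snd c)" using \<psi> by (simp add: homeomorphism_def)
  have inj: "inj_on (snd c) (fst c)"
    by (rule inj_on_inverseI) (rule homeomorphism_apply1[OF \<psi>])
  show 1: "chart_inv c (snd c p) = p" if "p \<in> fst c" for p
    using inj that by (simp add: chart_inv_def)
  show "snd c (chart_inv c y) = y" "chart_inv c y \<in> fst c" if "y \<in> snd c ` fst c" for y
    using that by (auto simp: chart_inv_def f_inv_into_f inv_into_into)
  have "chart_inv c y = \<psi> y" if "y \<in> snd c ` fst c" for y
    using that 1 \<psi> by (auto simp: homeomorphism_def)
  moreover have "continuous_on (snd c ` fst c) \<psi>" using \<psi> by (simp add: homeomorphism_def)
  ultimately show "continuous_on (snd c ` fst c) (chart_inv c)"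
    by (simp cong: continuous_on_cong)
qed

lemma ex_chart: "\<exists>c. c \<in> A \<and> p \<in> fst c"
proof -
  have "p \<in> (\<Union>c\<in>A. fst c)" using atlas by (simp add: smooth_atlas_def)
  then show ?thesis by blast
qed

lemma some_chart:
  "(SOME c. c \<in> A \<and> p \<in> fst c) \<in> A" "p \<in> fst (SOME c. c \<in> A \<and> p \<in> fst c)"
  using someI_ex[OF ex_chart] by auto

lemma
  assumes "c \<in> A" "p \<in> fst c"
  shows bilinear_metric: "bilinear (g c p)"
    and metric_pos: "v \<noteq> 0 \<Longrightarrow> 0 < g c p v v"
  using metric assms by (auto simp: riemannian_metric_def)

lemma metric_zero: "c \<in> A \<Longrightarrow> p \<in> fst c \<Longrightarrow> g c p 0 0 = 0"
  using bilinear_lzero[OF bilinear_metric] .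

lemma metric_nonneg: "c \<in> A \<Longrightarrow> p \<in> fst c \<Longrightarrow> 0 \<le> g c p v v"
  by (cases "v = 0") (auto simp: metric_zero less_imp_le metric_pos)

lemma metric_scale:
  assumes "c \<in> A" "p \<in> fst c"
  shows "g c p (s *\<^sub>R v) (s *\<^sub>R v) = s\<^sup>2 * g c p v v"
  using bilinear_lmul[OF bilinear_metric[OF assms]] bilinear_rmul[OF bilinear_metric[OF assms]]
  by (simp add: power2_eq_square)

lemma speed_sq_nonneg: "0 \<le> speed_sq A g \<alpha> t"
  unfolding speed_sq_def Let_def using metric_nonneg some_chart by blast

lemma compact_cball_model: "compact (cball (y::'e) r)"
  using atlas compact_cball_finite_span by (auto simp: smooth_atlas_def)

text \<open>In an orthonormal basis \<open>g (v, v)\<close> is a finite sum of products of the coordinates of \<open>v\<close> with the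
coefficients of the metric, all of which are continuous.\<close>

lemma continuous_on_metric:
  assumes c: "c \<in> A" and k: "continuous_on S k" "k ` S \<subseteq> fst c"
    and v: "continuous_on S v"
  shows "continuous_on S (\<lambda>z. g c (k z) (v z) (v z))"
proof -
  obtain B0 :: "'e set" where "finite B0" "span B0 = UNIV"
    using atlas by (auto simp: smooth_atlas_def)
  then obtain B :: "'e set" where B: "finite B" "\<And>v. (\<Sum>u\<in>B. (v \<bullet> u) *\<^sub>R u) = v"
    using ex_orthonormal_basis by blast
  have exp: "g c p x x = (\<Sum>(u, w)\<in>B \<times> B. (x \<bullet> u) * (x \<bullet> w) * g c p u w)"
    if "p \<in> fst c" for p x
  proof -
    note bil = bilinear_metric[OF c that]
    have "g c p x x = g c p (\<Sum>u\<in>B. (x \<bullet> u) *\<^sub>R u) (\<Sum>u\<in>B. (x \<bullet> u) *\<^sub>R u)"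
      by (simp only: B(2))
    also have "\<dots> = (\<Sum>(u, w)\<in>B \<times> B. g c p ((x \<bullet> u) *\<^sub>R u) ((x \<bullet> w) *\<^sub>R w))"
      by (rule bilinear_sum[OF bil])
    finally show ?thesis
      by (simp add: bilinear_lmul[OF bil] bilinear_rmul[OF bil] case_prod_beta mult_ac)
  qed
  have coeff: "continuous_on S (\<lambda>z. g c (k z) u w)" for u w
  proof -
    have "continuous_on (snd c ` fst c) (\<lambda>y. g c (chart_inv c y) u w)"
      using metric c by (auto simp: riemannian_metric_def intro: smooth_on_imp_continuous_on)
    moreover have "continuous_on S (\<lambda>z. snd c (k z))"
      using continuous_on_compose2[OF continuous_on_chart[OF c] k] .
    ultimately have "continuous_on S (\<lambda>z. g c (chart_inv c (snd c (k z))) u w)"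
      by (rule continuous_on_compose2) (use k in auto)
    moreover have "chart_inv c (snd c (k z)) = k z" if "z \<in> S" for z
      using chart_inv_chart[OF c] k(2) that by auto
    ultimately show ?thesis by (simp cong: continuous_on_cong)
  qed
  have "continuous_on S (\<lambda>z. \<Sum>(u, w)\<in>B \<times> B. (v z \<bullet> u) * (v z \<bullet> w) * g c (k z) u w)"
    unfolding case_prod_beta by (intro continuous_intros v coeff)
  then show ?thesis
    by (rule continuous_on_eq) (use exp k(2) in auto)
qed

text \<open>On the compact set of points \<open>(y, v)\<close> with \<open>y\<close> in a closed coordinate ball and \<open>v\<close> in the unit
sphere, the Riemannian norm is continuous and positive, hence bounded above and away from 0;
homogeneity extends the bounds to all \<open>v\<close>. The upper bound will make the Riemannian distance small
near \<open>p\<close>, the lower bound will make it positive.\<close>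

lemma metric_comparison:
  assumes c: "c \<in> A" and p: "p \<in> fst c"
  obtains r m M where "0 < r" "0 < m" "0 < M" "cball (snd c p) r \<subseteq> snd c ` fst c"
    "\<And>y v. y \<in> cball (snd c p) r \<Longrightarrow> m * norm v \<le> sqrt (g c (chart_inv c y) v v)"
    "\<And>y v. y \<in> cball (snd c p) r \<Longrightarrow> sqrt (g c (chart_inv c y) v v) \<le> M * norm v"
proof -
  have "\<exists>r>0. cball (snd c p) r \<subseteq> snd c ` fst c"
    by (rule bspec[OF open_contains_cball[THEN iffD1, OF open_chart_image[OF c]] imageI[OF p]])
  then obtain r where r: "0 < r" "cball (snd c p) r \<subseteq> snd c ` fst c"
    by (elim exE conjE)
  define K where "K = cball (snd c p) r \<times> sphere (0::'e) 1"
  define G where "G = (\<lambda>(y, v). sqrt (g c (chart_inv c y) v v))"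
  have "compact (cball (0::'e) 1 \<inter> {v. norm v = 1})"
    by (intro compact_Int_closed compact_cball_model closed_Collect_eq continuous_intros)
  moreover have "cball (0::'e) 1 \<inter> {v. norm v = 1} = sphere 0 1" by auto
  ultimately have "compact (sphere (0::'e) 1)" by simp
  then have K: "compact K" unfolding K_def by (intro compact_Times compact_cball_model)
  have dom: "chart_inv c y \<in> fst c" if "y \<in> cball (snd c p) r" for y
    using chart_inv_in[OF c] r(2) that by (meson subsetD)
  have G: "continuous_on K G"
    unfolding G_def case_prod_beta
    by (intro continuous_on_real_sqrt continuous_on_metric[OF c]
        continuous_on_compose2[OF continuous_on_chart_inv[OF c]] continuous_intros)
       (use r(2) dom in \<open>auto simp: K_def\<close>)
  have pos: "0 < G z" if "z \<in> K" for z
  proof -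
    obtain y v where z: "z = (y, v)" by (cases z)
    then have y: "y \<in> cball (snd c p) r" and "v \<noteq> 0"
      using that by (auto simp: K_def)
    then show ?thesis using metric_pos[OF c dom[OF y]] by (simp add: G_def z)
  qed
  have scale: "sqrt (g c (chart_inv c y) v v) = norm v * G (y, sgn v)"
    if y: "y \<in> cball (snd c p) r" for y v
  proof -
    have "g c (chart_inv c y) (norm v *\<^sub>R sgn v) (norm v *\<^sub>R sgn v)
        = (norm v)\<^sup>2 * g c (chart_inv c y) (sgn v) (sgn v)"
      by (rule metric_scale[OF c dom[OF y]])
    moreover have "norm v *\<^sub>R sgn v = v" by (cases "v = 0") (simp_all add: sgn_div_norm)
    ultimately show ?thesis by (simp add: G_def real_sqrt_mult)
  qed
  have inK: "(y, sgn v) \<in> K" if "y \<in> cball (snd c p) r" "v \<noteq> 0" for y v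
    using that by (auto simp: K_def norm_sgn)
  obtain m M where mM: "0 < m" "0 < M" "\<And>z. z \<in> K \<Longrightarrow> m \<le> G z" "\<And>z. z \<in> K \<Longrightarrow> G z \<le> M"
  proof (cases "K = {}")
    \<comment> \<open>In dimension 0 the unit sphere is empty, and any constants will do.\<close>
    case True
    then show ?thesis using that[of 1 1] by auto
  next
    case False
    obtain z where "z \<in> K" "\<forall>w\<in>K. G z \<le> G w"
      using continuous_attains_inf[OF K False G] by blast
    moreover obtain x where "x \<in> K" "\<forall>w\<in>K. G w \<le> G x"
      using continuous_attains_sup[OF K False G] by blast
    ultimately show ?thesis using that[of "G z" "G x"] pos by blast
  qed
  show thesis
  proof (rule that[OF r(1) mM(1,2) r(2)])
    fix y v assume y: "y \<in> cball (snd c p) r"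
    show "m * norm v \<le> sqrt (g c (chart_inv c y) v v)"
      using mM(3)[OF inK[OF y]] by (cases "v = 0") (auto simp: scale[OF y] mult.commute)
    show "sqrt (g c (chart_inv c y) v v) \<le> M * norm v"
      using mM(4)[OF inK[OF y]] by (cases "v = 0") (auto simp: scale[OF y] mult.commute)
  qed
qed

lemma chart_transition_derivative:
  assumes "c \<in> A" "d \<in> A" "p \<in> fst c" "p \<in> fst d"
  obtains T where "((snd d \<circ> chart_inv c) has_derivative T) (at (snd c p))"
proof -
  let ?W = "snd c ` (fst c \<inter> fst d)"
  have "?W = snd c ` fst c \<inter> chart_inv c -` fst d"
    using chart_inv_chart[OF assms(1)] by auto
  then have "open ?W"
    using continuous_on_open_vimage[OF open_chart_image[OF assms(1)], of "chart_inv c"]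
      continuous_on_chart_inv[OF assms(1)] open_chart_domain[OF assms(2)]
    by (metis Int_commute)
  moreover have "smooth_on ?W (snd d \<circ> chart_inv c)"
    using atlas assms by (auto simp: smooth_atlas_def)
  then obtain D where "\<forall>x\<in>?W. ((snd d \<circ> chart_inv c) has_derivative D x) (at x within ?W)"
    using smooth_on_imp_derivative by blast
  moreover have "snd c p \<in> ?W" using assms by simp
  ultimately have "((snd d \<circ> chart_inv c) has_derivative D (snd c p)) (at (snd c p))"
    using at_within_open by metis
  then show thesis by (rule that)
qed

text \<open>The two velocities are related by the derivative of the transition map (chain rule), and the
transformation law of the metric compensates for it.\<close>

lemma speed_chart_independent:
  assumes ch: "c \<in> A" "d \<in> A" and t: "t \<in> {a..b}" "a < b"
    and \<alpha>: "continuous_on {a..b} \<alpha>" "\<alpha> t \<in> fst c" "\<alpha> t \<in> fst d"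
    and u: "(snd c \<circ> \<alpha> has_vector_derivative u) (at t within {a..b})"
    and w: "(snd d \<circ> \<alpha> has_vector_derivative w) (at t within {a..b})"
  shows "g c (\<alpha> t) u u = g d (\<alpha> t) w w"
proof -
  obtain T where T: "((snd d \<circ> chart_inv c) has_derivative T) (at (snd c (\<alpha> t)))"
    using chart_transition_derivative[OF ch \<alpha>(2,3)] .
  have "((snd d \<circ> chart_inv c) \<circ> (snd c \<circ> \<alpha>) has_vector_derivative T u) (at t within {a..b})"
    by (rule vector_derivative_diff_chain_within[OF u]) (use T in \<open>simp add: o_def has_derivative_at_withinI\<close>)
  moreover obtain O' where O': "open O'" "{a..b} \<inter> \<alpha> -` fst c = {a..b} \<inter> O'"
    using continuous_openin_preimage_gen[OF \<alpha>(1) open_chart_domain[OF ch(1)]]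
    by (auto simp: openin_open)
  then obtain e where e: "0 < e" "ball t e \<subseteq> O'"
    using \<alpha>(2) t(1) open_contains_ball[of O'] by blast
  have "((snd d \<circ> chart_inv c) \<circ> (snd c \<circ> \<alpha>)) x = (snd d \<circ> \<alpha>) x" if "x \<in> {a..b}" "dist x t < e" for x
  proof -
    have "\<alpha> x \<in> fst c" using e O' that by (auto simp: dist_commute subset_iff)
    then show ?thesis using chart_inv_chart[OF ch(1)] by simp
  qed
  ultimately have "(snd d \<circ> \<alpha> has_vector_derivative T u) (at t within {a..b})"
    using has_vector_derivative_transform_within[OF _ e(1) t(1)] by blast
  moreover have "at t within {a..b} \<noteq> bot" using t by (simp add: trivial_limit_within islimpt_Icc)
  ultimately have "T u = w" using w by (blast intro: vector_derivative_unique_within)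
  moreover have "\<forall>u v. g c (\<alpha> t) u v = g d (\<alpha> t) (T u) (T v)"
    using metric ch \<alpha>(2,3) T unfolding riemannian_metric_def by blast
  ultimately show ?thesis by auto
qed

text \<open>The times that the curve spends in a chart domain form a relatively open subset of \<open>{a..b}\<close>. So the
derivative within this set, which is the one that \<open>smooth_curve_on\<close> speaks about, is the derivative
within \<open>{a..b}\<close>.\<close>

lemma smooth_curve_derivative:
  assumes \<alpha>: "smooth_curve_on A {a..b} \<alpha>" and c: "c \<in> A"
  shows "\<exists>w O'. open O' \<and> {t \<in> {a..b}. \<alpha> t \<in> fst c} = {a..b} \<inter> O' \<and>
    (\<forall>t\<in>{a..b}. \<alpha> t \<in> fst c \<longrightarrow> (snd c \<circ> \<alpha> has_vector_derivative w t) (at t within {a..b})) \<and>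
    continuous_on {t \<in> {a..b}. \<alpha> t \<in> fst c} w"
proof -
  let ?T = "{t \<in> {a..b}. \<alpha> t \<in> fst c}"
  have "continuous_on {a..b} \<alpha>" using \<alpha> by (simp add: smooth_curve_on_def)
  from continuous_openin_preimage_gen[OF this open_chart_domain[OF c]]
  obtain O' where O': "open O'" "?T = {a..b} \<inter> O'"
    by (auto simp: openin_open vimage_def Int_def)
  have "smooth_on ?T (snd c \<circ> \<alpha>)" using \<alpha> c by (simp add: smooth_curve_on_def)
  then obtain D where D: "\<forall>x\<in>?T. ((snd c \<circ> \<alpha>) has_derivative D x) (at x within ?T)"
    "\<forall>v. continuous_on ?T (\<lambda>x. D x v)" using smooth_on_imp_derivative by blast
  show ?thesis
  proof (intro exI conjI ballI impI)
    show "open O'" "?T = {a..b} \<inter> O'" by (rule O')+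
    fix t assume t: "t \<in> {a..b}" "\<alpha> t \<in> fst c"
    have at_eq: "at t within ?T = at t within {a..b}"
      by (rule at_within_nhd[of t O']) (use O' t in auto)
    have deriv: "(snd c \<circ> \<alpha> has_derivative D t) (at t within ?T)" using D(1) t by blast
    have lin: "D t = (\<lambda>x. x *\<^sub>R D t 1)"
    proof
      fix x
      show "D t x = x *\<^sub>R D t 1"
        using linear_scale[OF has_derivative_linear[OF deriv], of x 1] by simp
    qed
    show "(snd c \<circ> \<alpha> has_vector_derivative D t 1) (at t within {a..b})"
      unfolding has_vector_derivative_def lin[symmetric] at_eq[symmetric] by (rule deriv)
  qed (use D(2) in blast)
qed

text \<open>On a smooth piece the squared speed, with one-sided derivatives at the end points, is continuous
up to the end points: \<open>speed_sq\<close> selects a chart separately for each \<open>t\<close>, but near a given time it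
may be computed in one fixed chart.\<close>

lemma speed_continuous_extension:
  assumes \<alpha>: "smooth_curve_on A {a..b} \<alpha>" and ab: "a < b"
  shows "\<exists>S. continuous_on {a..b} S \<and> (\<forall>t\<in>{a<..<b}. speed_sq A g \<alpha> t = S t \<and>
    (\<forall>c\<in>A. \<alpha> t \<in> fst c \<longrightarrow>
       (\<exists>w. (snd c \<circ> \<alpha> has_vector_derivative w) (at t) \<and> g c (\<alpha> t) w w = S t)))"
proof -
  have cont: "continuous_on {a..b} \<alpha>" using \<alpha> by (simp add: smooth_curve_on_def)
  define ch where "ch t = (SOME c. c \<in> A \<and> \<alpha> t \<in> fst c)" for t
  define v where "v t = vector_derivative (snd (ch t) \<circ> \<alpha>) (at t within {a..b})" for t
  define S where "S t = g (ch t) (\<alpha> t) (v t) (v t)" for t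
  have ch: "ch t \<in> A" "\<alpha> t \<in> fst (ch t)" for t
    unfolding ch_def by (rule some_chart)+
  have v: "(snd (ch t) \<circ> \<alpha> has_vector_derivative v t) (at t within {a..b})" if "t \<in> {a..b}" for t
  proof -
    from smooth_curve_derivative[OF \<alpha> ch(1)[of t]] obtain w O' where
      "\<forall>s\<in>{a..b}. \<alpha> s \<in> fst (ch t) \<longrightarrow>
        (snd (ch t) \<circ> \<alpha> has_vector_derivative w s) (at s within {a..b})" by (elim exE conjE)
    then have "(snd (ch t) \<circ> \<alpha> has_vector_derivative w t) (at t within {a..b})"
      using that ch(2)[of t] by simp
    moreover from this have "v t = w t"
      unfolding v_def using vector_derivative_within_cbox[OF ab, of t "snd (ch t) \<circ> \<alpha>" "w t"] that by simp
    ultimately show ?thesis by simp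
  qed
  have S_eq: "S t = g c (\<alpha> t) w w"
    if "c \<in> A" "t \<in> {a..b}" "\<alpha> t \<in> fst c" "(snd c \<circ> \<alpha> has_vector_derivative w) (at t within {a..b})" for c t w
    unfolding S_def
    using speed_chart_independent[OF ch(1) that(1,2) ab cont ch(2) that(3) v[OF that(2)] that(4)] .
  show ?thesis
  proof (intro exI[of _ S] conjI ballI impI)
    show "continuous_on {a..b} S"
      unfolding continuous_on_eq_continuous_within
    proof
      fix t assume t: "t \<in> {a..b}"
      obtain w O' where w: "open O'" "{s \<in> {a..b}. \<alpha> s \<in> fst (ch t)} = {a..b} \<inter> O'"
        "\<forall>s\<in>{a..b}. \<alpha> s \<in> fst (ch t) \<longrightarrow>
          (snd (ch t) \<circ> \<alpha> has_vector_derivative w s) (at s within {a..b})"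
        "continuous_on {s \<in> {a..b}. \<alpha> s \<in> fst (ch t)} w"
        using smooth_curve_derivative[OF \<alpha> ch(1)[of t]] by (elim exE conjE)
      let ?T = "{s \<in> {a..b}. \<alpha> s \<in> fst (ch t)}"
      have "continuous_on ?T (\<lambda>s. g (ch t) (\<alpha> s) (w s) (w s))"
        by (rule continuous_on_metric[OF ch(1) continuous_on_subset[OF cont] _ w(4)]) auto
      then have "continuous_on ?T S"
        by (rule continuous_on_eq) (use S_eq[OF ch(1)] w(3) in auto)
      moreover have "t \<in> ?T" using t ch(2) by simp
      ultimately have "continuous (at t within ?T) S"
        by (simp add: continuous_on_eq_continuous_within)
      moreover have "at t within ?T = at t within {a..b}"
        by (rule at_within_nhd[of t O']) (use w(1,2) \<open>t \<in> ?T\<close> in auto)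
      ultimately show "continuous (at t within {a..b}) S" by simp
    qed
  next
    fix t assume t: "t \<in> {a<..<b}"
    then have t': "t \<in> {a..b}" and at: "at t within {a..b} = at t"
      by (auto simp: at_within_Icc_at)
    show "speed_sq A g \<alpha> t = S t"
      by (simp add: speed_sq_def Let_def S_def v_def ch_def at)
    fix c assume c: "c \<in> A" and \<alpha>t: "\<alpha> t \<in> fst c"
    from smooth_curve_derivative[OF \<alpha> c] obtain u O' where
      "\<forall>s\<in>{a..b}. \<alpha> s \<in> fst c \<longrightarrow>
        (snd c \<circ> \<alpha> has_vector_derivative u s) (at s within {a..b})" by (elim exE conjE)
    then obtain w where w: "(snd c \<circ> \<alpha> has_vector_derivative w) (at t within {a..b})"
      using \<alpha>t t' by blast
    then show "\<exists>w. (snd c \<circ> \<alpha> has_vector_derivative w) (at t) \<and> g c (\<alpha> t) w w = S t"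
      using S_eq[OF c t' \<alpha>t w] w at by auto
  qed
qed

lemma essbdd_on_speed_sq: "psmooth A a b \<alpha> \<Longrightarrow> essbdd_on a b (speed_sq A g \<alpha>)"
proof (induction rule: psmooth.induct)
  case (single a b \<alpha>)
  obtain S where "continuous_on {a..b} S" "\<forall>t\<in>{a<..<b}. speed_sq A g \<alpha> t = S t"
    using speed_continuous_extension[OF single(2,1)] by blast
  then show ?case by (intro essbdd_on_continuous_inside[of a b S]) auto
next
  case (join a m \<alpha> b)
  then show ?case
    using psmooth_less[OF join.hyps(1)] psmooth_less[OF join.hyps(2)] by (auto intro: essbdd_on_join)
qed

text \<open>This frees the later arguments from the chart selected in \<open>speed_sq\<close>: away from finitely many
times, the speed may be computed in whichever chart is convenient.\<close>

lemma speed_sq_in_chart: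
  "psmooth A a b \<alpha> \<Longrightarrow> \<exists>F. finite F \<and> (\<forall>t\<in>{a..b} - F. \<forall>c\<in>A. \<alpha> t \<in> fst c \<longrightarrow>
     (\<exists>w. (snd c \<circ> \<alpha> has_vector_derivative w) (at t) \<and> speed_sq A g \<alpha> t = g c (\<alpha> t) w w))"
proof (induction rule: psmooth.induct)
  case (single a b \<alpha>)
  obtain S where S: "\<forall>t\<in>{a<..<b}. speed_sq A g \<alpha> t = S t \<and> (\<forall>c\<in>A. \<alpha> t \<in> fst c \<longrightarrow>
       (\<exists>w. (snd c \<circ> \<alpha> has_vector_derivative w) (at t) \<and> g c (\<alpha> t) w w = S t))"
    using speed_continuous_extension[OF single(2,1)] by blast
  show ?case
  proof (intro exI[of _ "{a, b}"] conjI ballI impI)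
    fix t c assume t: "t \<in> {a..b} - {a, b}" and "c \<in> A" "\<alpha> t \<in> fst c"
    moreover from t have "t \<in> {a<..<b}" by auto
    ultimately show "\<exists>w. (snd c \<circ> \<alpha> has_vector_derivative w) (at t) \<and> speed_sq A g \<alpha> t = g c (\<alpha> t) w w"
      using S by metis
  qed simp
next
  case (join a m \<alpha> b)
  then obtain F F' where "finite F" "finite F'" and
    F: "\<forall>t\<in>{a..m} - F. \<forall>c\<in>A. \<alpha> t \<in> fst c \<longrightarrow>
     (\<exists>w. (snd c \<circ> \<alpha> has_vector_derivative w) (at t) \<and> speed_sq A g \<alpha> t = g c (\<alpha> t) w w)" and
    F': "\<forall>t\<in>{m..b} - F'. \<forall>c\<in>A. \<alpha> t \<in> fst c \<longrightarrow>
     (\<exists>w. (snd c \<circ> \<alpha> has_vector_derivative w) (at t) \<and> speed_sq A g \<alpha> t = g c (\<alpha> t) w w)" by blast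
  have "{a..b} - (F \<union> F') \<subseteq> ({a..m} - F) \<union> ({m..b} - F')" by auto
  then show ?case using F F' \<open>finite F\<close> \<open>finite F'\<close>
    by (intro exI[of _ "F \<union> F'"] conjI) blast+
qed

section \<open>The Riemannian distance\<close>

lemma essbdd_on_speed: "psmooth A a b \<alpha> \<Longrightarrow> essbdd_on a b (\<lambda>t. sqrt (speed_sq A g \<alpha> t))"
  by (intro essbdd_on_sqrt essbdd_on_speed_sq)

lemma has_integral_speed:
  "piecewise_smooth A \<alpha> \<Longrightarrow> ((\<lambda>t. sqrt (speed_sq A g \<alpha> t)) has_integral riem_length A g \<alpha>) {0..1}"
  unfolding riem_length_def by (intro essbdd_on_has_integral essbdd_on_speed) (simp add: piecewise_smooth_iff)

lemma riem_length_nonneg: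
  assumes "piecewise_smooth A \<alpha>"
  shows "0 \<le> riem_length A g \<alpha>"
  by (rule has_integral_nonneg[OF has_integral_speed[OF assms]]) (simp add: speed_sq_nonneg)

lemma riem_dist_le_length:
  assumes "piecewise_smooth A \<alpha>"
  shows "riem_dist A g (\<alpha> 0) (\<alpha> 1) \<le> riem_length A g \<alpha>"
  unfolding riem_dist_def
  by (rule cInf_lower) (use assms riem_length_nonneg in \<open>auto intro!: bdd_belowI[of _ 0]\<close>)

lemma speed_sq_const: "speed_sq A g (\<lambda>_. p) t = 0"
proof -
  define c where "c = (SOME c. c \<in> A \<and> p \<in> fst c)"
  have "c \<in> A" "p \<in> fst c" unfolding c_def by (rule some_chart)+
  then have "g c p 0 0 = 0" by (rule metric_zero)
  then show ?thesis by (simp add: speed_sq_def Let_def o_def c_def)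
qed

text \<open>The straight segment in the coordinates from the centre of the ball to \<open>z\<close> has constant coordinate
velocity \<open>z - snd c p\<close>, so its Riemannian speed is at most \<open>M\<close> times the norm of this vector.\<close>

lemma chart_segment:
  assumes c: "c \<in> A" and p: "p \<in> fst c"
    and ball: "cball (snd c p) r \<subseteq> snd c ` fst c" and z: "z \<in> cball (snd c p) r"
    and upper: "\<And>y v. y \<in> cball (snd c p) r \<Longrightarrow> sqrt (g c (chart_inv c y) v v) \<le> M * norm v"
  shows "\<exists>\<alpha>. piecewise_smooth A \<alpha> \<and> \<alpha> 0 = p \<and> \<alpha> 1 = chart_inv c z \<and>
    riem_length A g \<alpha> \<le> M * dist (snd c p) z"
proof -
  define y where "y = snd c p"
  define w where "w = z - y"
  define \<alpha> where "\<alpha> t = chart_inv c (y + t *\<^sub>R w)" for t :: real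
  have inball: "y + t *\<^sub>R w \<in> cball (snd c p) r" if "t \<in> {0..1}" for t
  proof -
    have "norm (t *\<^sub>R w) \<le> 1 * norm w"
      unfolding norm_scaleR by (rule mult_right_mono) (use that in auto)
    also have "\<dots> \<le> r" using z by (simp add: w_def y_def dist_norm norm_minus_commute)
    finally show ?thesis by (simp add: y_def dist_norm)
  qed
  have im: "y + t *\<^sub>R w \<in> snd c ` fst c" if "t \<in> {0..1}" for t
    using ball inball[OF that] by (rule subsetD)
  have \<alpha>c: "\<alpha> t \<in> fst c" "snd c (\<alpha> t) = y + t *\<^sub>R w" if "t \<in> {0..1}" for t
    unfolding \<alpha>_def by (rule chart_inv_in[OF c im[OF that]], rule chart_chart_inv[OF c im[OF that]])
  have smooth: "smooth_curve_on A {0..1} \<alpha>"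
    unfolding smooth_curve_on_def
  proof (intro conjI ballI)
    show "continuous_on {0..1} \<alpha>"
      unfolding \<alpha>_def
      by (rule continuous_on_compose2[OF continuous_on_chart_inv[OF c]])
         (use im in \<open>auto intro!: continuous_intros\<close>)
    fix d assume d: "d \<in> A"
    have "smooth_on (snd c ` (fst c \<inter> fst d)) (snd d \<circ> chart_inv c)"
      using atlas c d by (simp add: smooth_atlas_def)
    then have "smooth_on {t \<in> {0..1}. \<alpha> t \<in> fst d} (\<lambda>t. (snd d \<circ> chart_inv c) (y + t *\<^sub>R w))"
    proof (rule smooth_on_affine[OF _ bounded_linear_scaleR_left])
      fix t assume "t \<in> {t \<in> {0..1}. \<alpha> t \<in> fst d}"
      then have t: "t \<in> {0..1}" "\<alpha> t \<in> fst d" by auto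
      show "y + t *\<^sub>R w \<in> snd c ` (fst c \<inter> fst d)"
        by (rule image_eqI[of _ _ "\<alpha> t"]) (use \<alpha>c[OF t(1)] t(2) in auto)
    qed
    then show "smooth_on {t \<in> {0..1}. \<alpha> t \<in> fst d} (snd d \<circ> \<alpha>)"
      by (simp add: o_def \<alpha>_def)
  qed
  then have ps: "piecewise_smooth A \<alpha>" by (rule piecewise_smooth_single)
  then obtain F where F: "finite F" "\<And>t. t \<in> {0..1} - F \<Longrightarrow> \<alpha> t \<in> fst c \<Longrightarrow>
     \<exists>v. (snd c \<circ> \<alpha> has_vector_derivative v) (at t) \<and> speed_sq A g \<alpha> t = g c (\<alpha> t) v v"
    using speed_sq_in_chart[of 0 1 \<alpha>] c unfolding piecewise_smooth_iff by blast
  have "riem_length A g \<alpha> \<le> M * dist (snd c p) z"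
  proof (rule has_integral_le_off_finite[OF has_integral_speed[OF ps]])
    show "((\<lambda>_. M * dist (snd c p) z) has_integral (M * dist (snd c p) z)) {0..1::real}"
      using has_integral_const_real[of "M * dist (snd c p) z" 0 1] by simp
    show "finite (F \<union> {0, 1})" using F(1) by simp
    fix t :: real assume t: "t \<in> {0..1} - (F \<union> {0, 1})"
    then have t01: "t \<in> {0..1}" and tin: "t \<in> {0<..<1}" by auto
    obtain v where v: "(snd c \<circ> \<alpha> has_vector_derivative v) (at t)"
      "speed_sq A g \<alpha> t = g c (\<alpha> t) v v" using F(2)[of t] t \<alpha>c(1)[OF t01] by auto
    have "((\<lambda>s. y + s *\<^sub>R w) has_vector_derivative v) (at t)"
      by (rule has_vector_derivative_transform_within_open[OF v(1), of "{0<..<1}"])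
         (use tin \<alpha>c(2) in auto)
    moreover have "((\<lambda>s. y + s *\<^sub>R w) has_vector_derivative w) (at t)"
      by (auto intro!: derivative_eq_intros)
    ultimately have "v = w" by (rule vector_derivative_unique_at)
    then show "sqrt (speed_sq A g \<alpha> t) \<le> M * dist (snd c p) z"
      using upper[OF inball[OF t01], of w]
      by (simp add: v(2) \<alpha>_def w_def y_def dist_norm norm_minus_commute)
  qed
  moreover have "\<alpha> 0 = p" "\<alpha> 1 = chart_inv c z"
    using chart_inv_chart[OF c p] by (auto simp: \<alpha>_def y_def w_def)
  ultimately show ?thesis using ps by blast
qed

text \<open>The curves are asserted together with the estimate: they show that the infimum in \<open>riem_dist\<close> is
taken over a nonempty set, and they are the local ingredient of connectedness by curves.\<close>

lemma riem_dist_locally_small: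
  assumes "0 < \<epsilon>"
  shows "\<exists>U. open U \<and> p \<in> U \<and> (\<forall>q\<in>U. (\<exists>\<alpha>. piecewise_smooth A \<alpha> \<and> \<alpha> 0 = p \<and> \<alpha> 1 = q) \<and>
    riem_dist A g p q < \<epsilon>)"
proof -
  obtain c where c: "c \<in> A" and p: "p \<in> fst c" using ex_chart by blast
  obtain r m M where r: "0 < r" "cball (snd c p) r \<subseteq> snd c ` fst c" and M: "0 < M"
    "\<And>y v. y \<in> cball (snd c p) r \<Longrightarrow> sqrt (g c (chart_inv c y) v v) \<le> M * norm v"
    by (rule metric_comparison[OF c p], rule that)
  define s where "s = min r (\<epsilon> / M)"
  have s: "0 < s" "s \<le> r" "s \<le> \<epsilon> / M" using r M assms by (auto simp: s_def)
  define U where "U = fst c \<inter> snd c -` ball (snd c p) s"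
  have "open U"
    unfolding U_def using continuous_on_open_vimage[OF open_chart_domain[OF c]]
      continuous_on_chart[OF c] by (metis open_ball Int_commute)
  moreover have "p \<in> U" using p s by (simp add: U_def)
  moreover have "(\<exists>\<alpha>. piecewise_smooth A \<alpha> \<and> \<alpha> 0 = p \<and> \<alpha> 1 = q) \<and> riem_dist A g p q < \<epsilon>"
    if q: "q \<in> U" for q
  proof -
    have qc: "q \<in> fst c" "dist (snd c p) (snd c q) < s" using q by (auto simp: U_def)
    then have "snd c q \<in> cball (snd c p) r" using s by simp
    then have "\<exists>\<alpha>. piecewise_smooth A \<alpha> \<and> \<alpha> 0 = p \<and> \<alpha> 1 = chart_inv c (snd c q) \<and>
        riem_length A g \<alpha> \<le> M * dist (snd c p) (snd c q)"
      using M(2) by (rule chart_segment[OF c p r(2)])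
    then obtain \<alpha> where \<alpha>: "piecewise_smooth A \<alpha>" "\<alpha> 0 = p"
      "\<alpha> 1 = chart_inv c (snd c q)" "riem_length A g \<alpha> \<le> M * dist (snd c p) (snd c q)"
      by (elim exE conjE)
    have "\<alpha> 1 = q" using \<alpha>(3) chart_inv_chart[OF c qc(1)] by simp
    moreover have "M * dist (snd c p) (snd c q) < \<epsilon>"
    proof -
      have "dist (snd c p) (snd c q) < \<epsilon> / M" using qc(2) s(3) by linarith
      then show ?thesis using M(1) by (simp add: field_simps)
    qed
    ultimately show ?thesis using riem_dist_le_length[OF \<alpha>(1)] \<alpha> by auto
  qed
  ultimately show ?thesis by blast
qed

text \<open>Being joined by a piecewise smooth curve is an equivalence relation, and its classes are open
because nearby points are joined by coordinate segments.\<close>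

lemma ex_piecewise_smooth_curve:
  assumes "connected (UNIV :: 'a set)"
  shows "\<exists>\<alpha>. piecewise_smooth A \<alpha> \<and> \<alpha> 0 = p \<and> \<alpha> 1 = q"
proof (rule connected_equivalence_relation[OF assms, of p q])
  fix x y assume "\<exists>\<alpha>. piecewise_smooth A \<alpha> \<and> \<alpha> 0 = x \<and> \<alpha> 1 = y"
  then obtain \<alpha> where "piecewise_smooth A \<alpha>" "\<alpha> 0 = x" "\<alpha> 1 = y" by blast
  then show "\<exists>\<alpha>. piecewise_smooth A \<alpha> \<and> \<alpha> 0 = y \<and> \<alpha> 1 = x"
    by (intro exI[of _ "\<lambda>t. \<alpha> (1 - t)"]) (simp add: piecewise_smooth_reverse)
next
  fix x y z assume "\<exists>\<alpha>. piecewise_smooth A \<alpha> \<and> \<alpha> 0 = x \<and> \<alpha> 1 = y"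
    "\<exists>\<alpha>. piecewise_smooth A \<alpha> \<and> \<alpha> 0 = y \<and> \<alpha> 1 = z"
  then obtain \<alpha> \<beta> where "piecewise_smooth A \<alpha>" "\<alpha> 0 = x" "\<alpha> 1 = y"
    "piecewise_smooth A \<beta>" "\<beta> 0 = y" "\<beta> 1 = z" by blast
  then show "\<exists>\<alpha>. piecewise_smooth A \<alpha> \<and> \<alpha> 0 = x \<and> \<alpha> 1 = z"
    by (intro exI[of _ "concat_curve \<alpha> \<beta>"]) (simp add: piecewise_smooth_concat concat_curve_def)
next
  fix x :: 'a
  obtain U where "open U" "x \<in> U"
    "\<forall>q\<in>U. (\<exists>\<alpha>. piecewise_smooth A \<alpha> \<and> \<alpha> 0 = x \<and> \<alpha> 1 = q) \<and> riem_dist A g x q < 1"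
    using riem_dist_locally_small[of 1 x] by auto
  then show "\<exists>T. openin (top_of_set UNIV) T \<and> x \<in> T \<and>
      (\<forall>y\<in>T. \<exists>\<alpha>. piecewise_smooth A \<alpha> \<and> \<alpha> 0 = x \<and> \<alpha> 1 = y)"
    by (intro exI[of _ U]) auto
qed auto

text \<open>Let \<open>\<tau>\<close> be the first time at which the curve is outside the open coordinate ball \<open>V\<close>. The closed
coordinate ball \<open>K\<close> is compact, hence closed in the manifold, so the curve is still in \<open>K\<close> at time
\<open>\<tau>\<close> and its coordinate distance from \<open>p\<close> equals \<open>r\<close> there. The component \<open>u\<close> of the coordinates in
the direction \<open>e\<close> of the exit point goes from 0 to \<open>r\<close>, with \<open>u'\<close> at most the coordinate speed
and therefore at most the Riemannian speed divided by \<open>m\<close>. Using this component reduces the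
fundamental theorem of calculus to real functions.\<close>

lemma riem_length_exit_chart_ball:
  assumes c: "c \<in> A" and p: "p \<in> fst c" and r: "0 < r" "cball (snd c p) r \<subseteq> snd c ` fst c"
    and m: "0 < m" "\<And>y v. y \<in> cball (snd c p) r \<Longrightarrow> m * norm v \<le> sqrt (g c (chart_inv c y) v v)"
    and q: "q \<in> fst c \<Longrightarrow> r \<le> dist (snd c p) (snd c q)"
    and \<alpha>: "piecewise_smooth A \<alpha>" "\<alpha> 0 = p" "\<alpha> 1 = q"
  shows "m * r \<le> riem_length A g \<alpha>"
proof -
  have ps: "psmooth A 0 1 \<alpha>" using \<alpha>(1) by (simp add: piecewise_smooth_iff)
  have cont: "continuous_on {0..1} \<alpha>" using psmooth_imp_continuous_on[OF ps] .
  define V where "V = fst c \<inter> snd c -` ball (snd c p) r"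
  define K where "K = chart_inv c ` cball (snd c p) r"
  have "open V"
    unfolding V_def using continuous_on_open_vimage[OF open_chart_domain[OF c]]
      continuous_on_chart[OF c] by (metis open_ball Int_commute)
  have "compact K"
    unfolding K_def
    by (intro compact_continuous_image compact_cball_model
        continuous_on_subset[OF continuous_on_chart_inv[OF c] r(2)])
  then have "closed K" by (rule compact_imp_closed)
  have Kc: "x \<in> fst c" "snd c x \<in> cball (snd c p) r" "chart_inv c (snd c x) = x" if "x \<in> K" for x
  proof -
    obtain y where y: "x = chart_inv c y" "y \<in> cball (snd c p) r"
      using \<open>x \<in> K\<close> unfolding K_def by (rule imageE)
    have y': "y \<in> snd c ` fst c" using r(2) y(2) by (rule subsetD)
    show "x \<in> fst c" unfolding y(1) by (rule chart_inv_in[OF c y'])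
    then show "chart_inv c (snd c x) = x" by (rule chart_inv_chart[OF c])
    show "snd c x \<in> cball (snd c p) r" unfolding y(1) chart_chart_inv[OF c y'] by (rule y(2))
  qed
  have VK: "V \<subseteq> K"
  proof
    fix x assume "x \<in> V"
    then have "x \<in> fst c" "snd c x \<in> cball (snd c p) r" by (auto simp: V_def)
    then show "x \<in> K" unfolding K_def using chart_inv_chart[OF c] by (intro image_eqI[of _ _ "snd c x"]) auto
  qed
  define T where "T = {0..1} \<inter> \<alpha> -` (- V)"
  have "closed T"
    unfolding T_def by (rule continuous_closed_preimage[OF cont]) (use \<open>open V\<close> in auto)
  have "1 \<in> T" using q \<alpha>(3) by (force simp: T_def V_def)
  define \<tau> where "\<tau> = Inf T"
  have bdd: "bdd_below T" by (rule bdd_belowI[of _ 0]) (auto simp: T_def)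
  have "\<tau> \<in> T" unfolding \<tau>_def by (rule closed_contains_Inf[OF _ bdd \<open>closed T\<close>]) (use \<open>1 \<in> T\<close> in auto)
  then have \<tau>: "0 \<le> \<tau>" "\<tau> \<le> 1" "\<alpha> \<tau> \<notin> V" by (auto simp: T_def)
  have "p \<in> V" using p r(1) by (simp add: V_def)
  then have "\<tau> \<noteq> 0" using \<tau>(3) \<alpha>(2) by auto
  then have "0 < \<tau>" using \<tau>(1) by simp
  have before: "\<alpha> t \<in> V" if "0 \<le> t" "t < \<tau>" for t
  proof (rule ccontr)
    assume "\<alpha> t \<notin> V"
    then have "t \<in> T" using that \<tau>(2) by (simp add: T_def)
    then show False using cInf_lower[OF _ bdd, of t] that by (simp add: \<tau>_def)
  qed
  have inK: "\<alpha> t \<in> K" if "t \<in> {0..\<tau>}" for t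
  proof -
    have "closed ({0..\<tau>} \<inter> \<alpha> -` K)"
      by (rule continuous_closed_preimage[OF continuous_on_subset[OF cont]])
         (use \<open>closed K\<close> \<tau> in auto)
    moreover have "{0..<\<tau>} \<subseteq> {0..\<tau>} \<inter> \<alpha> -` K" using before subsetD[OF VK] by auto
    ultimately have "closure {0..<\<tau>} \<subseteq> {0..\<tau>} \<inter> \<alpha> -` K" by (rule closure_minimal[rotated])
    then show ?thesis using that \<open>0 < \<tau>\<close> by auto
  qed
  have "dist (snd c p) (snd c (\<alpha> \<tau>)) = r"
  proof -
    have "\<alpha> \<tau> \<in> K" using inK \<tau> by simp
    from Kc(1,2)[OF this] \<tau>(3) show ?thesis by (auto simp: V_def)
  qed
  then have norm_exit: "norm (snd c (\<alpha> \<tau>) - snd c p) = r" by (simp add: dist_norm norm_minus_commute)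
  define e where "e = sgn (snd c (\<alpha> \<tau>) - snd c p)"
  have e: "norm e = 1" using norm_exit r(1) by (auto simp: e_def norm_sgn)
  define u where "u t = (snd c (\<alpha> t) - snd c p) \<bullet> e" for t
  have u_end: "u 0 = 0" "u \<tau> = r"
    using \<alpha>(2) norm_exit r(1) by (auto simp: u_def e_def sgn_div_norm dot_square_norm power2_eq_square)
  obtain F where F: "finite F" "\<And>t. t \<in> {0..1} - F \<Longrightarrow> \<alpha> t \<in> fst c \<Longrightarrow>
     \<exists>v. (snd c \<circ> \<alpha> has_vector_derivative v) (at t) \<and> speed_sq A g \<alpha> t = g c (\<alpha> t) v v"
    using speed_sq_in_chart[OF ps] c by blast
  have u': "\<exists>v. (u has_vector_derivative v) (at t) \<and> v \<le> sqrt (speed_sq A g \<alpha> t) / m"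
    if "t \<in> {0..\<tau>} - F" for t
  proof -
    have t: "t \<in> {0..1} - F" "\<alpha> t \<in> K" using that \<tau>(2) inK by auto
    obtain v where v: "(snd c \<circ> \<alpha> has_vector_derivative v) (at t)" "speed_sq A g \<alpha> t = g c (\<alpha> t) v v"
      using F(2)[OF t(1) Kc(1)[OF t(2)]] by blast
    have "(u has_vector_derivative v \<bullet> e) (at t)"
      unfolding u_def using bounded_linear.has_vector_derivative[OF bounded_linear_inner_left,
          OF has_vector_derivative_diff[OF v(1) has_vector_derivative_const[of "snd c p"]], of e]
      by (simp add: o_def)
    moreover have "v \<bullet> e \<le> norm v" using norm_cauchy_schwarz[of v e] e by simp
    moreover have "m * norm v \<le> sqrt (speed_sq A g \<alpha> t)"
      using m(2)[OF Kc(2)[OF t(2)], of v] Kc(3)[OF t(2)] v(2) by simp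
    then have "norm v \<le> sqrt (speed_sq A g \<alpha> t) / m" using m(1) by (simp add: field_simps)
    ultimately show ?thesis by (meson order_trans)
  qed
  have "((\<lambda>t. vector_derivative u (at t)) has_integral (u \<tau> - u 0)) {0..\<tau>}"
  proof (rule fundamental_theorem_of_calculus_interior_strong[OF F(1)])
    show "continuous_on {0..\<tau>} u"
      unfolding u_def
      by (intro continuous_intros continuous_on_compose2[OF continuous_on_chart[OF c] continuous_on_subset[OF cont]])
         (use \<tau> inK Kc(1) in auto)
    show "(u has_vector_derivative vector_derivative u (at t)) (at t)" if "t \<in> {0<..<\<tau>} - F" for t
      using u'[of t] that by (auto simp: vector_derivative_at)
  qed (use \<tau> in auto)
  then have u_int: "((\<lambda>t. vector_derivative u (at t)) has_integral r) {0..\<tau>}" by (simp add: u_end)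
  have int: "(\<lambda>t. sqrt (speed_sq A g \<alpha> t)) integrable_on {0..1}"
    using has_integral_speed[OF \<alpha>(1)] by blast
  then have int\<tau>: "(\<lambda>t. sqrt (speed_sq A g \<alpha> t)) integrable_on {0..\<tau>}"
    by (rule integrable_on_subinterval) (use \<tau> in auto)
  then have "((\<lambda>t. sqrt (speed_sq A g \<alpha> t) / m) has_integral
      integral {0..\<tau>} (\<lambda>t. sqrt (speed_sq A g \<alpha> t)) / m) {0..\<tau>}"
    by (intro has_integral_divide integrable_integral)
  from has_integral_le_off_finite[OF u_int this F(1)]
  have "r \<le> integral {0..\<tau>} (\<lambda>t. sqrt (speed_sq A g \<alpha> t)) / m"
    using u' vector_derivative_at by metis
  then have "m * r \<le> integral {0..\<tau>} (\<lambda>t. sqrt (speed_sq A g \<alpha> t))"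
    using m(1) by (simp add: field_simps)
  also have "\<dots> \<le> integral {0..1} (\<lambda>t. sqrt (speed_sq A g \<alpha> t))"
    by (rule integral_subset_le[OF _ int\<tau> int]) (use \<tau> speed_sq_nonneg in auto)
  also have "\<dots> = riem_length A g \<alpha>"
    using has_integral_speed[OF \<alpha>(1)] by (rule integral_unique)
  finally show ?thesis .
qed

lemma
  assumes "connected (UNIV :: 'a set)"
  shows riem_dist_greatest: "(\<And>\<alpha>. piecewise_smooth A \<alpha> \<Longrightarrow> \<alpha> 0 = p \<Longrightarrow> \<alpha> 1 = q \<Longrightarrow> l \<le> riem_length A g \<alpha>)
      \<Longrightarrow> l \<le> riem_dist A g p q"
    and riem_dist_nonneg: "0 \<le> riem_dist A g p q"
proof -
  have ne: "{riem_length A g \<alpha> |\<alpha>. piecewise_smooth A \<alpha> \<and> \<alpha> 0 = p \<and> \<alpha> 1 = q} \<noteq> {}"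
    using ex_piecewise_smooth_curve[OF assms, of p q] by blast
  show *: "l \<le> riem_dist A g p q"
    if "\<And>\<alpha>. piecewise_smooth A \<alpha> \<Longrightarrow> \<alpha> 0 = p \<Longrightarrow> \<alpha> 1 = q \<Longrightarrow> l \<le> riem_length A g \<alpha>" for l
    unfolding riem_dist_def by (rule cInf_greatest[OF ne]) (use that in blast)
  show "0 \<le> riem_dist A g p q" by (rule *) (rule riem_length_nonneg)
qed

text \<open>A curve from \<open>p\<close> to \<open>q\<close> has to leave any coordinate ball around \<open>p\<close> that does not contain \<open>q\<close>.\<close>

lemma riem_dist_pos:
  assumes "connected (UNIV :: 'a set)" "p \<noteq> q"
  shows "0 < riem_dist A g p q"
proof -
  obtain c where c: "c \<in> A" and p: "p \<in> fst c" using ex_chart by blast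
  obtain r m M where r: "0 < r" "cball (snd c p) r \<subseteq> snd c ` fst c" and m: "0 < m"
    "\<And>y v. y \<in> cball (snd c p) r \<Longrightarrow> m * norm v \<le> sqrt (g c (chart_inv c y) v v)"
    by (rule metric_comparison[OF c p], rule that)
  \<comment> \<open>A radius for which \<open>q\<close> is outside the open coordinate ball.\<close>
  define s where "s = (if q \<in> fst c then min r (dist (snd c p) (snd c q)) else r)"
  have "snd c p \<noteq> snd c q" if "q \<in> fst c"
    using chart_inv_chart[OF c p] chart_inv_chart[OF c that] assms(2) by auto
  then have s: "0 < s" "s \<le> r" "q \<in> fst c \<Longrightarrow> s \<le> dist (snd c p) (snd c q)"
    using r(1) by (auto simp: s_def)
  have "m * s \<le> riem_dist A g p q"
  proof (rule riem_dist_greatest[OF assms(1)])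
    fix \<alpha> assume \<alpha>: "piecewise_smooth A \<alpha>" "\<alpha> 0 = p" "\<alpha> 1 = q"
    have sub: "cball (snd c p) s \<subseteq> cball (snd c p) r" using s(2) by (rule subset_cball)
    show "m * s \<le> riem_length A g \<alpha>"
    proof (rule riem_length_exit_chart_ball[OF c p s(1) _ m(1) _ s(3) \<alpha>])
      show "cball (snd c p) s \<subseteq> snd c ` fst c" using sub r(2) by (rule order_trans)
      show "m * norm v \<le> sqrt (g c (chart_inv c y) v v)" if "y \<in> cball (snd c p) s" for y v
        using m(2)[OF subsetD[OF sub that]] .
    qed
  qed
  then show ?thesis using mult_pos_pos[OF m(1) s(1)] by linarith
qed

end

section \<open>Curves in a warped product\<close>

abbreviation real_atlas :: "(real, real) chart set" where
  "real_atlas \<equiv> {(UNIV, \<lambda>x. x)}"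

text \<open>The interval carries the metric \<open>dx\<^sup>2\<close>. Regarded as a Riemannian manifold, the real line inherits the
regularity results on speeds, which thus apply to the first component of a curve in the warped
product.\<close>

interpretation real_line: riemannian real_atlas "\<lambda>_ _ u v. u * v"
proof
  have inv: "chart_inv (UNIV, \<lambda>x::real. x) = (\<lambda>x. x)"
    by (rule ext) (simp add: chart_inv_def inv_f_eq)
  have "span {1::real} = UNIV"
    by (auto simp: span_singleton)
  moreover have "homeomorphism UNIV UNIV (\<lambda>x::real. x) (\<lambda>x. x)"
    by (simp add: homeomorphism_def)
  ultimately show "smooth_atlas real_atlas"
    by (auto simp: smooth_atlas_def is_chart_def inv o_def smooth_on_ident intro!: exI[of _ "{1::real}"])
  have T: "T = (\<lambda>x. x)" if "((\<lambda>x::real. x) has_derivative T) (at y)" for T y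
    using has_derivative_unique[OF that has_derivative_ident] .
  have "bilinear (\<lambda>u v::real. u * v)"
    by (simp add: bilinear_def linear_iff algebra_simps)
  then show "riemannian_metric real_atlas (\<lambda>_ _ u v. u * v)"
    by (auto simp: riemannian_metric_def inv o_def smooth_on_const zero_less_mult_iff
        linorder_neq_iff dest!: T)
qed

lemma psmooth_real_deriv:
  assumes "psmooth real_atlas a b x"
  shows "\<exists>F. finite F \<and> (\<forall>t\<in>{a..b} - F. (x has_vector_derivative deriv x t) (at t) \<and>
    (deriv x t)\<^sup>2 = speed_sq real_atlas (\<lambda>_ _ u v. u * v) x t)"
proof -
  obtain F where F: "finite F" "\<forall>t\<in>{a..b} - F.
     \<exists>w. (x has_vector_derivative w) (at t) \<and> speed_sq real_atlas (\<lambda>_ _ u v. u * v) x t = w * w"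
    using real_line.speed_sq_in_chart[OF assms] by (auto simp: o_def)
  have "(x has_vector_derivative deriv x t) (at t) \<and>
    (deriv x t)\<^sup>2 = speed_sq real_atlas (\<lambda>_ _ u v. u * v) x t" if "t \<in> {a..b} - F" for t
  proof -
    from bspec[OF F(2) that] obtain w where w: "(x has_vector_derivative w) (at t)"
      "speed_sq real_atlas (\<lambda>_ _ u v. u * v) x t = w * w" by (elim exE conjE)
    then have "deriv x t = w"
      by (intro DERIV_imp_deriv) (simp add: has_real_derivative_iff_has_vector_derivative)
    then show ?thesis using w by (simp add: power2_eq_square)
  qed
  then show ?thesis using F(1) by (intro exI[of _ F]) simp
qed

lemma essbdd_on_deriv_sq:
  assumes "psmooth real_atlas a b x"
  shows "essbdd_on a b (\<lambda>t. (deriv x t)\<^sup>2)"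
proof -
  from psmooth_real_deriv[OF assms] obtain F where "finite F"
    "\<forall>t\<in>{a..b} - F. (x has_vector_derivative deriv x t) (at t) \<and>
      (deriv x t)\<^sup>2 = speed_sq real_atlas (\<lambda>_ _ u v. u * v) x t" by (elim exE conjE)
  then show ?thesis
    by (intro essbdd_on_cong_finite[OF real_line.essbdd_on_speed_sq[OF assms]]) auto
qed

lemma piecewise_smooth_affine_real: "piecewise_smooth real_atlas (\<lambda>t. a + t * b)"
proof (rule piecewise_smooth_single)
  have "smooth_on {0..1} (\<lambda>t. a + t * b)"
    using smooth_on_affine[OF smooth_on_ident[of UNIV] bounded_linear_mult_left[of b], of "{0..1}" a] by simp
  then show "smooth_curve_on real_atlas {0..1} (\<lambda>t. a + t * b)"
    by (auto simp: smooth_curve_on_def o_def simp del: atLeastAtMost_iff intro!: continuous_intros)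
qed

lemma affine_mem_Icc:
  fixes x y :: real
  assumes "x \<in> {a..b}" "y \<in> {a..b}" "t \<in> {0..1}"
  shows "x + t * (y - x) \<in> {a..b}"
  using convexD_alt[OF convex_real_interval(5) assms(1,2), of t] assms(3) by (simp add: algebra_simps)

definition warped_speed where
  "warped_speed A g f \<gamma> t =
     sqrt ((deriv (fst \<circ> \<gamma>) t)\<^sup>2 + (f (fst (\<gamma> t)))\<^sup>2 * speed_sq A g (snd \<circ> \<gamma>) t)"

lemma warped_length_eq: "warped_length A g f \<gamma> = (LINT t:{0..1}|lborel. warped_speed A g f \<gamma> t)"
  by (simp add: warped_length_def warped_speed_def)

text \<open>The speed depends on the germ of the curve only; this transfers it from the two halves of a
concatenated curve.\<close>

lemma warped_speed_cong:
  fixes A :: "('a::topological_space, 'e::real_normed_vector) chart set"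
    and \<gamma> \<delta> :: "real \<Rightarrow> real \<times> 'a"
  assumes "open S" "t \<in> S" "\<And>s. s \<in> S \<Longrightarrow> \<gamma> s = \<delta> s"
  shows "warped_speed A g f \<gamma> t = warped_speed A g f \<delta> t"
proof -
  have ev: "eventually (\<lambda>s. \<gamma> s = \<delta> s) (nhds t)"
    using assms by (auto simp: eventually_nhds)
  have "deriv (fst \<circ> \<gamma>) t = deriv (fst \<circ> \<delta>) t"
    by (rule deriv_cong_ev[OF _ refl]) (use ev in \<open>auto elim: eventually_mono\<close>)
  moreover have "vector_derivative (h \<circ> (snd \<circ> \<gamma>)) (at t) = vector_derivative (h \<circ> (snd \<circ> \<delta>)) (at t)"
    for h :: "'a \<Rightarrow> 'e"
    by (rule vector_derivative_cong_eq) (use ev in \<open>auto elim: eventually_mono\<close>)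
  ultimately show ?thesis
    using assms(2,3) by (simp add: warped_speed_def speed_sq_def Let_def)
qed

text \<open>All estimates concern one warping function at a time; the sequence enters only when a convergent
subsequence is extracted.\<close>

locale warped_product = riemannian A g
  for A :: "('a::{t2_space, second_countable_topology}, 'e::real_inner) chart set" and g +
  fixes t0 t1 lo hi :: real and f :: "real \<Rightarrow> real" and Q :: "real set"
  assumes interval: "t0 < t1" and connected: "connected (UNIV :: 'a set)"
    and lo: "0 < lo" "lo < 1" and hi: "1 \<le> hi"
    and bounded: "bounded (f ` {t0..t1})"
    and measurable: "f \<in> borel_measurable (restrict_space borel {t0..t1})"
    and Q: "Q \<subseteq> {t0..t1}" "{t0..t1} \<subseteq> closure Q"
    and le_hi: "\<And>q. q \<in> Q \<Longrightarrow> f q \<le> hi"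
    and lo_le: "\<And>x. x \<in> {t0..t1} \<Longrightarrow> lo \<le> f x"
begin

abbreviation "M \<equiv> warped_space t0 t1 :: (real \<times> 'a) set"
abbreviation "curve \<equiv> warped_curve t0 t1 A"
abbreviation "speed \<equiv> warped_speed A g f"
abbreviation "len \<equiv> warped_length A g f"
abbreviation "wd \<equiv> warped_dist t0 t1 A g f"

lemma warped_curve_components:
  assumes "curve \<gamma>"
  shows "psmooth real_atlas 0 1 (fst \<circ> \<gamma>)" "psmooth A 0 1 (snd \<circ> \<gamma>)"
    "\<And>t. t \<in> {0..1} \<Longrightarrow> fst (\<gamma> t) \<in> {t0..t1}"
proof -
  show "psmooth real_atlas 0 1 (fst \<circ> \<gamma>)" "psmooth A 0 1 (snd \<circ> \<gamma>)"
    using assms by (simp_all add: warped_curve_def piecewise_smooth_iff)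
  show "fst (\<gamma> t) \<in> {t0..t1}" if "t \<in> {0..1}" for t
  proof -
    have "\<gamma> t \<in> M" using assms imageI[OF that, of \<gamma>] unfolding warped_curve_def by (meson subsetD)
    then show ?thesis by (simp add: warped_space_def mem_Times_iff)
  qed
qed

text \<open>The two components of a curve may have different break points; both are regular away from the
union of the two finite exceptional sets.\<close>

lemma warped_curve_regular:
  assumes "curve \<gamma>"
  shows "\<exists>F. finite F \<and> (\<forall>t\<in>{0..1} - F. (fst \<circ> \<gamma> has_vector_derivative deriv (fst \<circ> \<gamma>) t) (at t) \<and>
    (\<forall>ch\<in>A. snd (\<gamma> t) \<in> fst ch \<longrightarrow> (\<exists>w. (snd ch \<circ> (snd \<circ> \<gamma>) has_vector_derivative w) (at t))))"
proof -
  from psmooth_real_deriv[OF warped_curve_components(1)[OF assms]] obtain F where F: "finite F"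
    "\<forall>t\<in>{0..1} - F. (fst \<circ> \<gamma> has_vector_derivative deriv (fst \<circ> \<gamma>) t) (at t) \<and>
      (deriv (fst \<circ> \<gamma>) t)\<^sup>2 = speed_sq real_atlas (\<lambda>_ _ u v. u * v) (fst \<circ> \<gamma>) t" by (elim exE conjE)
  from speed_sq_in_chart[OF warped_curve_components(2)[OF assms]] obtain G where G: "finite G"
    "\<forall>t\<in>{0..1} - G. \<forall>ch\<in>A. (snd \<circ> \<gamma>) t \<in> fst ch \<longrightarrow>
      (\<exists>w. (snd ch \<circ> (snd \<circ> \<gamma>) has_vector_derivative w) (at t) \<and>
        speed_sq A g (snd \<circ> \<gamma>) t = g ch ((snd \<circ> \<gamma>) t) w w)" by (elim exE conjE)
  show ?thesis
  proof (intro exI[of _ "F \<union> G"] conjI ballI impI)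
    show "finite (F \<union> G)" using F(1) G(1) by simp
    fix t assume "t \<in> {0..1} - (F \<union> G)"
    then have t: "t \<in> {0..1} - F" "t \<in> {0..1} - G" by simp_all
    show "(fst \<circ> \<gamma> has_vector_derivative deriv (fst \<circ> \<gamma>) t) (at t)" using bspec[OF F(2) t(1)] by (rule conjunct1)
    fix ch assume ch: "ch \<in> A" "snd (\<gamma> t) \<in> fst ch"
    have "(snd \<circ> \<gamma>) t \<in> fst ch" using ch(2) by simp
    from mp[OF bspec[OF bspec[OF G(2) t(2)] ch(1)] this]
    obtain w where "(snd ch \<circ> (snd \<circ> \<gamma>) has_vector_derivative w) (at t)" by (elim exE conjE)
    then show "\<exists>w. (snd ch \<circ> (snd \<circ> \<gamma>) has_vector_derivative w) (at t)" by (rule exI)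
  qed
qed

lemma essbdd_on_warped_speed:
  assumes \<gamma>: "curve \<gamma>"
  shows "essbdd_on 0 1 (speed \<gamma>)"
proof -
  note comps = warped_curve_components[OF \<gamma>]
  have "essbdd_on 0 1 (\<lambda>t. f (fst (\<gamma> t)))"
  proof -
    have "continuous_on {0..1} (fst \<circ> \<gamma>)" by (rule psmooth_imp_continuous_on[OF comps(1)])
    then have "fst \<circ> \<gamma> \<in> borel_measurable (restrict_space borel {0..1})"
      by (rule borel_measurable_continuous_on_restrict)
    then have "fst \<circ> \<gamma> \<in> measurable (restrict_space borel {0..1}) (restrict_space borel {t0..t1})"
      by (rule measurable_restrict_space2[rotated]) (use comps(3) in \<open>auto simp: space_restrict_space\<close>)
    from measurable_compose[OF this measurable]
    have "(\<lambda>t. f (fst (\<gamma> t))) \<in> borel_measurable (restrict_space borel {0..1})" by simp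
    moreover obtain B where "\<forall>y\<in>f ` {t0..t1}. norm y \<le> B" using bounded by (auto simp: bounded_iff)
    then have "\<forall>t\<in>{0..1} - {}. \<bar>f (fst (\<gamma> t))\<bar> \<le> B" using comps(3) by auto
    ultimately show ?thesis unfolding essbdd_on_def by (meson finite.emptyI)
  qed
  then show ?thesis
    unfolding warped_speed_def power2_eq_square[of "f _"]
    by (intro essbdd_on_sqrt essbdd_on_add essbdd_on_mult essbdd_on_deriv_sq comps essbdd_on_speed_sq)
qed

lemma has_integral_warped_speed: "curve \<gamma> \<Longrightarrow> (speed \<gamma> has_integral len \<gamma>) {0..1}"
  unfolding warped_length_eq by (intro essbdd_on_has_integral essbdd_on_warped_speed)

lemma warped_speed_nonneg: "0 \<le> speed \<gamma> t"
  by (simp add: warped_speed_def speed_sq_nonneg)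

lemma warped_length_nonneg: "curve \<gamma> \<Longrightarrow> 0 \<le> len \<gamma>"
  using has_integral_nonneg[OF has_integral_warped_speed] warped_speed_nonneg by blast

lemma warped_speed_affine:
  assumes x: "(fst \<circ> \<gamma> has_vector_derivative deriv (fst \<circ> \<gamma>) (b + m * t)) (at (b + m * t))"
    and \<alpha>: "\<forall>ch\<in>A. snd (\<gamma> (b + m * t)) \<in> fst ch \<longrightarrow>
      (\<exists>w. (snd ch \<circ> (snd \<circ> \<gamma>) has_vector_derivative w) (at (b + m * t)))"
  shows "speed (\<lambda>s. \<gamma> (b + m * s)) t = \<bar>m\<bar> * speed \<gamma> (b + m * t)"
proof -
  have l: "((\<lambda>s. b + m * s) has_vector_derivative m) (at t)"
    by (auto intro!: derivative_eq_intros)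
  have chain: "((\<lambda>s. h (b + m * s)) has_vector_derivative m *\<^sub>R w) (at t)"
    if "(h has_vector_derivative w) (at (b + m * t))" for h :: "real \<Rightarrow> 'z::real_normed_vector" and w
    using vector_diff_chain_at[OF l that] by (simp add: o_def)
  have d: "deriv (fst \<circ> (\<lambda>s. \<gamma> (b + m * s))) t = m * deriv (fst \<circ> \<gamma>) (b + m * t)"
    using chain[OF x] by (intro DERIV_imp_deriv) (simp add: has_real_derivative_iff_has_vector_derivative o_def)
  define ch where "ch = (SOME ch. ch \<in> A \<and> snd (\<gamma> (b + m * t)) \<in> fst ch)"
  have ch: "ch \<in> A" "snd (\<gamma> (b + m * t)) \<in> fst ch" unfolding ch_def by (rule some_chart)+
  obtain w where w: "(snd ch \<circ> (snd \<circ> \<gamma>) has_vector_derivative w) (at (b + m * t))"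
    using \<alpha> ch by blast
  have "vector_derivative (snd ch \<circ> (snd \<circ> (\<lambda>s. \<gamma> (b + m * s)))) (at t) = m *\<^sub>R w"
    using chain[OF w] by (intro vector_derivative_at) (simp add: o_def)
  moreover have "vector_derivative (snd ch \<circ> (snd \<circ> \<gamma>)) (at (b + m * t)) = w"
    using w by (rule vector_derivative_at)
  ultimately have "speed_sq A g (snd \<circ> (\<lambda>s. \<gamma> (b + m * s))) t = m\<^sup>2 * speed_sq A g (snd \<circ> \<gamma>) (b + m * t)"
    using metric_scale[OF ch, of m w] by (simp add: speed_sq_def ch_def[symmetric])
  then have "speed (\<lambda>s. \<gamma> (b + m * s)) t =
      sqrt (m\<^sup>2 * ((deriv (fst \<circ> \<gamma>) (b + m * t))\<^sup>2 + (f (fst (\<gamma> (b + m * t))))\<^sup>2 * speed_sq A g (snd \<circ> \<gamma>) (b + m * t)))"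
    unfolding warped_speed_def d by (simp add: algebra_simps power_mult_distrib)
  then show ?thesis by (simp add: warped_speed_def real_sqrt_mult)
qed

lemma warped_speed_affine_finite:
  assumes "curve \<gamma>" "m \<noteq> 0"
  shows "\<exists>F. finite F \<and> (\<forall>t. b + m * t \<in> {0..1} \<and> t \<notin> F \<longrightarrow>
    speed (\<lambda>s. \<gamma> (b + m * s)) t = \<bar>m\<bar> * speed \<gamma> (b + m * t))"
proof -
  obtain F where F: "finite F" "\<forall>t\<in>{0..1} - F. (fst \<circ> \<gamma> has_vector_derivative deriv (fst \<circ> \<gamma>) t) (at t) \<and>
    (\<forall>ch\<in>A. snd (\<gamma> t) \<in> fst ch \<longrightarrow> (\<exists>w. (snd ch \<circ> (snd \<circ> \<gamma>) has_vector_derivative w) (at t)))"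
    using warped_curve_regular[OF assms(1)] by blast
  have "finite ((\<lambda>t. b + m * t) -` F)"
    using F(1) by (rule finite_vimageI) (use assms(2) in \<open>simp add: inj_on_def\<close>)
  moreover have "\<forall>t. b + m * t \<in> {0..1} \<and> t \<notin> (\<lambda>t. b + m * t) -` F \<longrightarrow>
    speed (\<lambda>s. \<gamma> (b + m * s)) t = \<bar>m\<bar> * speed \<gamma> (b + m * t)"
    using F(2) warped_speed_affine[of \<gamma> b m] by (auto simp del: atLeastAtMost_iff)
  ultimately show ?thesis by blast
qed

text \<open>Substitution under an affine change of parameter that carries \<open>{u..v}\<close> onto \<open>{0..1}\<close>, in either
direction: \<open>m = -1\<close> reverses a curve, and \<open>m = 2\<close> yields the halves of a concatenated curve.\<close>

lemma has_integral_warped_speed_affine: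
  assumes \<gamma>: "curve \<gamma>" and m: "m \<noteq> 0" and ends: "{b + m * u, b + m * v} = {0, 1}" "u < v"
  shows "(speed (\<lambda>s. \<gamma> (b + m * s)) has_integral len \<gamma>) {u..v}"
proof -
  obtain F where F: "finite F" "\<And>t. b + m * t \<in> {0..1} \<Longrightarrow> t \<notin> F \<Longrightarrow>
    speed (\<lambda>s. \<gamma> (b + m * s)) t = \<bar>m\<bar> * speed \<gamma> (b + m * t)"
    using warped_speed_affine_finite[OF \<gamma> m, of b] by blast
  have iff: "b + m * t \<in> {0..1} \<longleftrightarrow> t \<in> {u..v}" for t
  proof -
    consider "b + m * u = 0" "b + m * v = 1" | "b + m * u = 1" "b + m * v = 0"
      using ends(1) by (auto simp: doubleton_eq_iff)
    then show ?thesis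
    proof cases
      case 1
      then have b: "b = - m * u" "m * (v - u) = 1" by (auto simp: algebra_simps)
      then have "0 < m" using ends(2) by (metis diff_gt_0_iff_gt zero_less_mult_pos2 zero_less_one)
      moreover have "b + m * t = m * (t - u)" by (simp add: b algebra_simps)
      moreover have "m * (t - u) \<le> 1 \<longleftrightarrow> m * (t - u) \<le> m * (v - u)" by (simp add: b)
      ultimately show ?thesis by (auto simp: zero_le_mult_iff)
    next
      case 2
      then have b: "b = - m * v" "- m * (v - u) = 1" by (auto simp: algebra_simps)
      then have "0 < - m" using ends(2) by (metis diff_gt_0_iff_gt zero_less_mult_pos2 zero_less_one)
      moreover have "b + m * t = - m * (v - t)" by (simp add: b algebra_simps)
      moreover have "- m * (v - t) \<le> 1 \<longleftrightarrow> - m * (v - t) \<le> - m * (v - u)" by (simp only: b)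
      ultimately show ?thesis by (auto simp: zero_le_mult_iff mult_le_0_iff)
    qed
  qed
  have sub: "b + m * t \<in> {0..1}" if "t \<in> {u..v}" for t using iff that by blast
  have im: "(\<lambda>x. (1 / m) *\<^sub>R x + - ((1 / m) *\<^sub>R b)) ` cbox 0 1 = {u..v}"
  proof (intro set_eqI iffI)
    fix y assume "y \<in> {u..v}"
    then show "y \<in> (\<lambda>x. (1 / m) *\<^sub>R x + - ((1 / m) *\<^sub>R b)) ` cbox 0 1"
      using sub[of y] m by (intro image_eqI[of _ _ "b + m * y"]) (auto simp: field_simps)
  next
    fix y assume "y \<in> (\<lambda>x. (1 / m) *\<^sub>R x + - ((1 / m) *\<^sub>R b)) ` cbox 0 1"
    then obtain x where x: "x \<in> {0..1}" "y = (1 / m) * x - (1 / m) * b" by auto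
    then have "b + m * y = x" using m by (simp add: field_simps)
    then show "y \<in> {u..v}" using iff[of y] x(1) by simp
  qed
  from has_integral_affinity[of "speed \<gamma>" "len \<gamma>" 0 1 m b] has_integral_warped_speed[OF \<gamma>] m im
  have "((\<lambda>t. speed \<gamma> (b + m * t)) has_integral (1 / \<bar>m\<bar>) * len \<gamma>) {u..v}"
    by (simp add: add.commute)
  from has_integral_mult_right[OF this, of "\<bar>m\<bar>"] m
  have "((\<lambda>t. \<bar>m\<bar> * speed \<gamma> (b + m * t)) has_integral len \<gamma>) {u..v}" by simp
  then show ?thesis
    by (rule has_integral_spike_finite[OF F(1), rotated]) (use F(2) sub in auto)
qed

lemma warped_curve_reverse: "curve \<gamma> \<Longrightarrow> curve (\<lambda>t. \<gamma> (1 - t))"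
  using piecewise_smooth_reverse[of real_atlas "fst \<circ> \<gamma>"] piecewise_smooth_reverse[of A "snd \<circ> \<gamma>"]
  by (auto simp: warped_curve_def o_def)

lemma warped_length_reverse:
  assumes "curve \<gamma>"
  shows "len (\<lambda>t. \<gamma> (1 - t)) = len \<gamma>"
proof -
  have "(speed (\<lambda>s. \<gamma> (1 + -1 * s)) has_integral len \<gamma>) {0..1}"
    by (rule has_integral_warped_speed_affine[OF assms]) auto
  then have "(speed (\<lambda>t. \<gamma> (1 - t)) has_integral len \<gamma>) {0..1}" by simp
  with has_integral_warped_speed[OF warped_curve_reverse[OF assms]]
  show ?thesis by (rule has_integral_unique)
qed

lemma warped_curve_concat:
  assumes "curve \<gamma>" "curve \<delta>" "\<gamma> 1 = \<delta> 0"
  shows "curve (concat_curve \<gamma> \<delta>)"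
proof -
  have eq: "fst \<circ> concat_curve \<gamma> \<delta> = concat_curve (fst \<circ> \<gamma>) (fst \<circ> \<delta>)"
    "snd \<circ> concat_curve \<gamma> \<delta> = concat_curve (snd \<circ> \<gamma>) (snd \<circ> \<delta>)"
    by (auto simp: concat_curve_def)
  have "concat_curve \<gamma> \<delta> t \<in> M" if t: "t \<in> {0..1}" for t
  proof (cases "t \<le> 1/2")
    case True
    then have "2 * t \<in> {0..1}" using t by auto
    then show ?thesis using assms(1) True by (auto simp: warped_curve_def concat_curve_def)
  next
    case False
    then have "2 * t - 1 \<in> {0..1}" using t by auto
    then show ?thesis using assms(2) False by (auto simp: warped_curve_def concat_curve_def)
  qed
  then show ?thesis
    using assms unfolding warped_curve_def eq
    by (auto intro!: piecewise_smooth_concat)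
qed

lemma warped_length_concat:
  assumes \<gamma>: "curve \<gamma>" and \<delta>: "curve \<delta>" and eq: "\<gamma> 1 = \<delta> 0"
  shows "len (concat_curve \<gamma> \<delta>) = len \<gamma> + len \<delta>"
proof -
  have "(speed (\<lambda>s. \<gamma> (0 + 2 * s)) has_integral len \<gamma>) {0..1/2}"
    by (rule has_integral_warped_speed_affine[OF \<gamma>]) auto
  then have 1: "(speed (concat_curve \<gamma> \<delta>) has_integral len \<gamma>) {0..1/2}"
    by (rule has_integral_spike_finite[of "{1/2}", rotated 2])
       (auto intro!: warped_speed_cong[of "{..<1/2}"] simp: concat_curve_def)
  have "(speed (\<lambda>s. \<delta> (-1 + 2 * s)) has_integral len \<delta>) {1/2..1}"
    by (rule has_integral_warped_speed_affine[OF \<delta>]) auto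
  then have 2: "(speed (concat_curve \<gamma> \<delta>) has_integral len \<delta>) {1/2..1}"
    by (rule has_integral_spike_finite[of "{1/2}", rotated 2])
       (auto intro!: warped_speed_cong[of "{1/2<..}"] simp: concat_curve_def)
  have "(speed (concat_curve \<gamma> \<delta>) has_integral (len \<gamma> + len \<delta>)) {0..1}"
    by (rule has_integral_combine[OF _ _ 1 2]) auto
  with has_integral_warped_speed[OF warped_curve_concat[OF assms]]
  show ?thesis by (rule has_integral_unique)
qed

lemma ex_warped_curve:
  assumes "p \<in> M" "q \<in> M"
  shows "\<exists>\<gamma>. curve \<gamma> \<and> \<gamma> 0 = p \<and> \<gamma> 1 = q"
proof -
  obtain \<alpha> where \<alpha>: "piecewise_smooth A \<alpha>" "\<alpha> 0 = snd p" "\<alpha> 1 = snd q"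
    using ex_piecewise_smooth_curve[OF connected] by blast
  define \<gamma> where "\<gamma> t = (fst p + t * (fst q - fst p), \<alpha> t)" for t
  have "fst p + t * (fst q - fst p) \<in> {t0..t1}" if "t \<in> {0..1}" for t
    using assms that by (intro affine_mem_Icc) (auto simp: warped_space_def)
  then have "curve \<gamma>"
    using \<alpha>(1) piecewise_smooth_affine_real by (auto simp: warped_curve_def \<gamma>_def o_def warped_space_def)
  moreover have "\<gamma> 0 = p" "\<gamma> 1 = q" using \<alpha> by (auto simp: \<gamma>_def)
  ultimately show ?thesis by blast
qed

lemma warped_dist_le_length: "curve \<gamma> \<Longrightarrow> wd (\<gamma> 0) (\<gamma> 1) \<le> len \<gamma>"
proof -
  assume \<gamma>: "curve \<gamma>"
  then have "\<gamma> 0 \<in> M" "\<gamma> 1 \<in> M" by (auto simp: warped_curve_def)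
  then show ?thesis
    unfolding warped_dist_def
    using \<gamma> warped_length_nonneg by (auto intro!: cInf_lower bdd_belowI[of _ 0])
qed

lemma warped_dist_greatest:
  assumes "p \<in> M" "q \<in> M" "\<And>\<gamma>. curve \<gamma> \<Longrightarrow> \<gamma> 0 = p \<Longrightarrow> \<gamma> 1 = q \<Longrightarrow> l \<le> len \<gamma>"
  shows "l \<le> wd p q"
proof -
  have "{len \<gamma> |\<gamma>. curve \<gamma> \<and> \<gamma> 0 = p \<and> \<gamma> 1 = q} \<noteq> {}"
    using ex_warped_curve[OF assms(1,2)] by blast
  then have "l \<le> Inf {len \<gamma> |\<gamma>. curve \<gamma> \<and> \<gamma> 0 = p \<and> \<gamma> 1 = q}"
    by (rule cInf_greatest) (use assms(3) in blast)
  then show ?thesis using assms(1,2) by (simp add: warped_dist_def)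
qed

lemma warped_dist_nonneg: "0 \<le> wd p q"
proof (cases "p \<in> M \<and> q \<in> M")
  case True
  then show ?thesis using warped_dist_greatest warped_length_nonneg by blast
next
  case False
  then show ?thesis by (simp only: warped_dist_def if_False order_refl)
qed

lemma warped_dist_reverse_le:
  assumes "p \<in> M" "q \<in> M"
  shows "wd p q \<le> wd q p"
proof (rule warped_dist_greatest[OF assms(2,1)])
  fix \<gamma> assume \<gamma>: "curve \<gamma>" "\<gamma> 0 = q" "\<gamma> 1 = p"
  show "wd p q \<le> len \<gamma>"
    using warped_dist_le_length[OF warped_curve_reverse[OF \<gamma>(1)]] warped_length_reverse[OF \<gamma>(1)] \<gamma>(2,3)
    by simp
qed

lemma warped_dist_sym: "wd p q = wd q p"
proof (cases "p \<in> M \<and> q \<in> M")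
  case True
  then show ?thesis using warped_dist_reverse_le[of p q] warped_dist_reverse_le[of q p] by simp
next
  case False
  then show ?thesis by (auto simp: warped_dist_def)
qed

lemma warped_dist_triangle:
  assumes "p \<in> M" "q \<in> M" "s \<in> M"
  shows "wd p s \<le> wd p q + wd q s"
proof -
  have "wd p s - len \<gamma> \<le> wd q s" if \<gamma>: "curve \<gamma>" "\<gamma> 0 = p" "\<gamma> 1 = q" for \<gamma>
  proof (rule warped_dist_greatest[OF assms(2,3)])
    fix \<delta> assume \<delta>: "curve \<delta>" "\<delta> 0 = q" "\<delta> 1 = s"
    have "\<gamma> 1 = \<delta> 0" using \<gamma> \<delta> by simp
    from warped_dist_le_length[OF warped_curve_concat[OF \<gamma>(1) \<delta>(1) this]]
      warped_length_concat[OF \<gamma>(1) \<delta>(1) this] \<gamma>(2) \<delta>(3)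
    show "wd p s - len \<gamma> \<le> len \<delta>" by (simp add: concat_curve_def)
  qed
  note le = this
  have "wd p s - wd q s \<le> wd p q"
  proof (rule warped_dist_greatest[OF assms(1,2)])
    fix \<gamma> assume "curve \<gamma>" "\<gamma> 0 = p" "\<gamma> 1 = q"
    from le[OF this] show "wd p s - wd q s \<le> len \<gamma>" by simp
  qed
  then show ?thesis by simp
qed

text \<open>With \<open>a\<close> and \<open>b\<close> the distances of the two components and \<open>D = sqrt (a\<^sup>2 + b\<^sup>2)\<close>, the Cauchy-Schwarz
inequality gives \<open>D * speed \<gamma> t \<ge> lo * (a * \<bar>x' t\<bar> + b * \<sigma> t)\<close> pointwise. The integrals of \<open>\<bar>x'\<bar>\<close> and
\<open>\<sigma>\<close> over a curve from \<open>p\<close> to \<open>q\<close> are at least \<open>a\<close> and \<open>b\<close>, so integration bounds \<open>D\<close> times the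
length from below by \<open>lo * (a\<^sup>2 + b\<^sup>2) = lo * D\<^sup>2\<close>.\<close>

lemma ref_dist_le_warped_dist:
  assumes "p \<in> M" "q \<in> M"
  shows "lo * ref_dist A g p q \<le> wd p q"
proof (rule warped_dist_greatest[OF assms])
  fix \<gamma> assume \<gamma>: "curve \<gamma>" "\<gamma> 0 = p" "\<gamma> 1 = q"
  note comps = warped_curve_components[OF \<gamma>(1)]
  define D where "D = ref_dist A g p q"
  define a where "a = \<bar>fst q - fst p\<bar>"
  define b where "b = riem_dist A g (snd p) (snd q)"
  define x' where "x' = deriv (fst \<circ> \<gamma>)"
  define \<sigma> where "\<sigma> t = sqrt (speed_sq A g (snd \<circ> \<gamma>) t)" for t
  have b: "0 \<le> b" unfolding b_def by (rule riem_dist_nonneg[OF connected])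
  have D: "0 \<le> D" "D\<^sup>2 = a\<^sup>2 + b\<^sup>2" by (simp_all add: D_def ref_dist_def a_def b_def)
  obtain F where F: "finite F" "\<forall>t\<in>{0..1} - F. (fst \<circ> \<gamma> has_vector_derivative x' t) (at t)"
    using warped_curve_regular[OF \<gamma>(1)] unfolding x'_def by blast
  have x'_int: "(x' has_integral (fst \<circ> \<gamma>) 1 - (fst \<circ> \<gamma>) 0) {0..1}"
  proof (rule fundamental_theorem_of_calculus_interior_strong[OF F(1)])
    show "continuous_on {0..1} (fst \<circ> \<gamma>)" by (rule psmooth_imp_continuous_on[OF comps(1)])
    show "(fst \<circ> \<gamma> has_vector_derivative x' t) (at t)" if "t \<in> {0<..<1} - F" for t
      by (rule bspec[OF F(2)]) (use that in auto)
  qed simp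
  define I where "I = (LINT t:{0..1}|lborel. \<bar>x' t\<bar>)"
  have "essbdd_on 0 1 (\<lambda>t. \<bar>x' t\<bar>)"
    using essbdd_on_sqrt[OF essbdd_on_deriv_sq[OF comps(1)]] by (simp add: x'_def)
  then have I: "((\<lambda>t. \<bar>x' t\<bar>) has_integral I) {0..1}"
    unfolding I_def by (rule essbdd_on_has_integral)
  have "(fst \<circ> \<gamma>) 1 - (fst \<circ> \<gamma>) 0 \<le> I" by (rule has_integral_le[OF x'_int I]) auto
  moreover have "- ((fst \<circ> \<gamma>) 1 - (fst \<circ> \<gamma>) 0) \<le> I"
    by (rule has_integral_le[OF has_integral_neg[OF x'_int] I]) auto
  ultimately have aI: "a \<le> I" using \<gamma> by (simp add: a_def)
  have ps: "piecewise_smooth A (snd \<circ> \<gamma>)" using comps(2) by (simp add: piecewise_smooth_iff)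
  have \<sigma>: "(\<sigma> has_integral riem_length A g (snd \<circ> \<gamma>)) {0..1}"
    unfolding \<sigma>_def by (rule has_integral_speed[OF ps])
  have bl: "b \<le> riem_length A g (snd \<circ> \<gamma>)"
    using riem_dist_le_length[OF ps] \<gamma> by (simp add: b_def)
  have "lo * (a * I + b * riem_length A g (snd \<circ> \<gamma>)) \<le> D * len \<gamma>"
  proof (rule has_integral_le)
    show "((\<lambda>t. lo * (a * \<bar>x' t\<bar> + b * \<sigma> t)) has_integral lo * (a * I + b * riem_length A g (snd \<circ> \<gamma>))) {0..1}"
      by (intro has_integral_mult_right has_integral_add I \<sigma>)
    show "((\<lambda>t. D * speed \<gamma> t) has_integral D * len \<gamma>) {0..1}"
      by (intro has_integral_mult_right has_integral_warped_speed \<gamma>)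
    fix t :: real assume t: "t \<in> {0..1}"
    define S where "S = speed_sq A g (snd \<circ> \<gamma>) t"
    have S: "0 \<le> S" "\<sigma> t = sqrt S" by (simp_all add: S_def \<sigma>_def speed_sq_nonneg)
    have "a * \<bar>x' t\<bar> + b * \<sigma> t \<le> D * sqrt ((x' t)\<^sup>2 + S)"
    proof (rule power2_le_imp_le)
      have "(D * sqrt ((x' t)\<^sup>2 + S))\<^sup>2 = (a\<^sup>2 + b\<^sup>2) * (\<bar>x' t\<bar>\<^sup>2 + (\<sigma> t)\<^sup>2)"
        using S D by (simp add: power_mult_distrib)
      moreover have "0 \<le> (a * \<sigma> t - b * \<bar>x' t\<bar>)\<^sup>2" by simp
      ultimately show "(a * \<bar>x' t\<bar> + b * \<sigma> t)\<^sup>2 \<le> (D * sqrt ((x' t)\<^sup>2 + S))\<^sup>2"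
        by (simp add: power2_eq_square algebra_simps)
    qed (use S D in simp)
    then have "lo * (a * \<bar>x' t\<bar> + b * \<sigma> t) \<le> D * (lo * sqrt ((x' t)\<^sup>2 + S))"
      using mult_left_mono[of _ _ lo] lo by (simp add: mult.left_commute)
    also have "lo * sqrt ((x' t)\<^sup>2 + S) \<le> speed \<gamma> t"
    proof -
      have "lo\<^sup>2 * (x' t)\<^sup>2 \<le> 1 * (x' t)\<^sup>2"
        using lo by (intro mult_right_mono) (auto simp: power_le_one)
      moreover have "lo\<^sup>2 * S \<le> (f (fst (\<gamma> t)))\<^sup>2 * S"
        using lo lo_le[OF comps(3)[OF t]] S by (intro mult_right_mono power_mono) auto
      ultimately have "sqrt (lo\<^sup>2 * ((x' t)\<^sup>2 + S)) \<le> speed \<gamma> t"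
        unfolding warped_speed_def S_def x'_def by (intro real_sqrt_le_mono) (simp add: algebra_simps)
      then show ?thesis using lo by (simp add: real_sqrt_mult)
    qed
    finally show "lo * (a * \<bar>x' t\<bar> + b * \<sigma> t) \<le> D * speed \<gamma> t"
      using D(1) by (simp add: mult_left_mono)
  qed
  moreover have "D\<^sup>2 \<le> a * I + b * riem_length A g (snd \<circ> \<gamma>)"
    unfolding D(2) unfolding power2_eq_square by (intro add_mono mult_left_mono aI bl b) (simp add: a_def)
  then have "lo * D\<^sup>2 \<le> lo * (a * I + b * riem_length A g (snd \<circ> \<gamma>))" using lo by simp
  ultimately have "D * (lo * D) \<le> D * len \<gamma>" by (simp add: power2_eq_square algebra_simps)
  then have "lo * D \<le> len \<gamma>"
    using D(1) warped_length_nonneg[OF \<gamma>(1)] by (cases "D = 0") auto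
  then show "lo * ref_dist A g p q \<le> len \<gamma>" by (simp add: D_def)
qed

lemma warped_dist_vertical:
  assumes "x \<in> {t0..t1}" "y \<in> {t0..t1}"
  shows "wd (x, a) (y, a) \<le> \<bar>y - x\<bar>"
proof -
  define \<gamma> where "\<gamma> t = (x + t * (y - x), a)" for t :: real
  have "x + t * (y - x) \<in> {t0..t1}" if "t \<in> {0..1}" for t
    using assms that by (rule affine_mem_Icc)
  then have \<gamma>: "curve \<gamma>"
    using piecewise_smooth_affine_real piecewise_smooth_single[OF smooth_curve_on_const]
    by (auto simp: warped_curve_def \<gamma>_def o_def warped_space_def)
  have "deriv (\<lambda>t. x + t * (y - x)) t = y - x" for t
    by (rule DERIV_imp_deriv) (auto intro!: derivative_eq_intros)
  then have "speed \<gamma> = (\<lambda>_. \<bar>y - x\<bar>)"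
    by (intro ext) (simp add: warped_speed_def \<gamma>_def o_def speed_sq_const)
  then have "(speed \<gamma> has_integral \<bar>y - x\<bar>) {0..1}"
    using has_integral_const_real[of "\<bar>y - x\<bar>" 0 1] by simp
  then have "len \<gamma> = \<bar>y - x\<bar>"
    by (rule has_integral_unique[OF has_integral_warped_speed[OF \<gamma>]])
  then show ?thesis using warped_dist_le_length[OF \<gamma>] by (simp add: \<gamma>_def)
qed

lemma warped_dist_horizontal:
  assumes r: "r \<in> {t0..t1}"
  shows "wd (r, a) (r, b) \<le> f r * riem_dist A g a b"
proof -
  have fr: "0 < f r" using lo_le[OF r] lo by simp
  have "wd (r, a) (r, b) / f r \<le> riem_dist A g a b"
  proof (rule riem_dist_greatest[OF connected])
    fix \<alpha> assume \<alpha>: "piecewise_smooth A \<alpha>" "\<alpha> 0 = a" "\<alpha> 1 = b"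
    define \<gamma> where "\<gamma> t = (r, \<alpha> t)" for t
    have \<gamma>: "curve \<gamma>"
      using \<alpha>(1) r piecewise_smooth_single[OF smooth_curve_on_const]
      by (auto simp: warped_curve_def \<gamma>_def o_def warped_space_def)
    have "speed \<gamma> = (\<lambda>t. f r * sqrt (speed_sq A g \<alpha> t))"
      using fr by (intro ext) (simp add: warped_speed_def \<gamma>_def o_def real_sqrt_mult)
    then have "(speed \<gamma> has_integral f r * riem_length A g \<alpha>) {0..1}"
      using has_integral_mult_right[OF has_integral_speed[OF \<alpha>(1)], of "f r"] by simp
    then have "len \<gamma> = f r * riem_length A g \<alpha>"
      by (rule has_integral_unique[OF has_integral_warped_speed[OF \<gamma>]])
    then show "wd (r, a) (r, b) / f r \<le> riem_length A g \<alpha>"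
      using warped_dist_le_length[OF \<gamma>] \<alpha> fr by (simp add: \<gamma>_def field_simps)
  qed
  then show ?thesis using fr by (simp add: field_simps)
qed

text \<open>Since \<open>Q\<close> is dense, there is a level \<open>r \<in> Q\<close> as close to \<open>x\<close> as desired. Going from \<open>(x, a)\<close> to
\<open>(r, a)\<close>, then at this level to \<open>(r, b)\<close>, and finally to \<open>(y, b)\<close>, costs at most
\<open>\<bar>y - x\<bar> + hi * R\<close> up to an arbitrarily small error. The warping function is seen by this path at
the level \<open>r\<close> only, and there it is at most \<open>hi\<close>.\<close>

lemma warped_dist_le_ref_dist:
  assumes "p \<in> M" "q \<in> M"
  shows "wd p q \<le> sqrt 2 * hi * ref_dist A g p q"
proof -
  obtain x a where p: "p = (x, a)" by (cases p)
  obtain y b where q: "q = (y, b)" by (cases q)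
  have xy: "x \<in> {t0..t1}" "y \<in> {t0..t1}" using assms by (auto simp: p q warped_space_def)
  define R where "R = riem_dist A g a b"
  have R: "0 \<le> R" unfolding R_def by (rule riem_dist_nonneg[OF connected])
  have "wd p q \<le> \<bar>y - x\<bar> + hi * R"
  proof (rule field_le_epsilon)
    fix \<epsilon> :: real assume "0 < \<epsilon>"
    moreover have "x \<in> closure Q" using Q(2) xy(1) by blast
    ultimately obtain r where r: "r \<in> Q" "dist r x < \<epsilon> / 2"
      unfolding closure_approachable by (meson half_gt_zero)
    have r': "r \<in> {t0..t1}" using Q(1) r(1) by blast
    have inM: "(x, a) \<in> M" "(r, a) \<in> M" "(r, b) \<in> M" "(y, b) \<in> M"
      using xy r' by (auto simp: warped_space_def)
    have "wd p q \<le> wd (x, a) (r, a) + (wd (r, a) (r, b) + wd (r, b) (y, b))"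
      unfolding p q using warped_dist_triangle[OF inM(1,2,4)] warped_dist_triangle[OF inM(2,3,4)] by linarith
    also have "\<dots> \<le> \<bar>r - x\<bar> + (hi * R + \<bar>y - r\<bar>)"
    proof (intro add_mono warped_dist_vertical xy r')
      have "wd (r, a) (r, b) \<le> f r * R" unfolding R_def by (rule warped_dist_horizontal[OF r'])
      also have "\<dots> \<le> hi * R" using le_hi[OF r(1)] R by (rule mult_right_mono)
      finally show "wd (r, a) (r, b) \<le> hi * R" .
    qed
    also have "\<dots> \<le> \<bar>y - x\<bar> + hi * R + \<epsilon>" using r(2) unfolding dist_real_def by linarith
    finally show "wd p q \<le> \<bar>y - x\<bar> + hi * R + \<epsilon>" .
  qed
  also have "\<dots> \<le> hi * (\<bar>y - x\<bar> + R)"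
    using mult_right_mono[OF hi, of "\<bar>y - x\<bar>"] by (simp add: algebra_simps)
  also have "\<dots> \<le> hi * (sqrt 2 * sqrt (\<bar>y - x\<bar>\<^sup>2 + R\<^sup>2))"
  proof (intro mult_left_mono)
    have "(\<bar>y - x\<bar> + R)\<^sup>2 \<le> 2 * (\<bar>y - x\<bar>\<^sup>2 + R\<^sup>2)"
      using zero_le_power2[of "\<bar>y - x\<bar> - R"] by (simp add: power2_eq_square algebra_simps)
    then have "sqrt ((\<bar>y - x\<bar> + R)\<^sup>2) \<le> sqrt (2 * (\<bar>y - x\<bar>\<^sup>2 + R\<^sup>2))" by (rule real_sqrt_le_mono)
    moreover have "sqrt ((\<bar>y - x\<bar> + R)\<^sup>2) = \<bar>y - x\<bar> + R" using R by simp
    ultimately show "\<bar>y - x\<bar> + R \<le> sqrt 2 * sqrt (\<bar>y - x\<bar>\<^sup>2 + R\<^sup>2)"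
      by (simp only: real_sqrt_mult)
  qed (use hi in simp)
  finally show ?thesis by (simp add: ref_dist_def p q R_def mult_ac)
qed

lemma Metric_space_warped_dist: "Metric_space M wd"
proof
  show "0 \<le> wd p q" for p q by (rule warped_dist_nonneg)
  show "wd p q = wd q p" for p q by (rule warped_dist_sym)
  show "wd p s \<le> wd p q + wd q s" if "p \<in> M" "q \<in> M" "s \<in> M" for p q s
    using that by (rule warped_dist_triangle)
  show "wd p q = 0 \<longleftrightarrow> p = q" if pq: "p \<in> M" "q \<in> M" for p q
  proof
    assume "wd p q = 0"
    then have "lo * ref_dist A g p q \<le> 0" using ref_dist_le_warped_dist[OF pq] by simp
    then have "sqrt (\<bar>fst q - fst p\<bar>\<^sup>2 + (riem_dist A g (snd p) (snd q))\<^sup>2) \<le> 0"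
      using lo by (simp add: ref_dist_def mult_le_0_iff)
    then have "\<bar>fst q - fst p\<bar>\<^sup>2 + (riem_dist A g (snd p) (snd q))\<^sup>2 = 0"
      by (smt (verit) real_sqrt_le_0_iff zero_le_power2)
    then have "fst q = fst p" "riem_dist A g (snd p) (snd q) = 0"
      by (simp_all add: add_nonneg_eq_0_iff)
    moreover from this have "snd p = snd q" using riem_dist_pos[OF connected, of "snd p" "snd q"] by force
    ultimately show "p = q" by (simp add: prod_eq_iff)
  next
    assume "p = q"
    then have "wd p q \<le> 0"
      using warped_dist_vertical[of "fst p" "fst p" "snd p"] pq by (auto simp: warped_space_def)
    then show "wd p q = 0" using warped_dist_nonneg[of p q] by simp
  qed
qed

end

section \<open>Uniform limits of equivalent metrics\<close>

text \<open>A version of the Arzela-Ascoli theorem. The union of finite \<open>\<rho>\<close>-nets of radii tending to 0 is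
countable, so a diagonal argument yields a subsequence that converges at all pairs of net points.
By the triangle inequality, replacing two arbitrary points by net points of radius \<open>\<delta>\<close> changes every
\<open>d n\<close> by at most \<open>2 * L * \<delta>\<close>; as one net has only finitely many pairs of points, the subsequence is
uniformly Cauchy.\<close>

lemma uniformly_convergent_subsequence_of_dominated_metrics:
  fixes d :: "nat \<Rightarrow> 'x \<Rightarrow> 'x \<Rightarrow> real" and \<rho> :: "'x \<Rightarrow> 'x \<Rightarrow> real"
  assumes metric: "\<And>n. Metric_space M (d n)"
    and L: "0 < L" and dom: "\<And>n p q. p \<in> M \<Longrightarrow> q \<in> M \<Longrightarrow> d n p q \<le> L * \<rho> p q"
    and nets: "\<And>e. 0 < e \<Longrightarrow> \<exists>P. finite P \<and> P \<subseteq> M \<and> (\<forall>q\<in>M. \<exists>p\<in>P. \<rho> p q < e)"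
  shows "\<exists>r l. strict_mono (r :: nat \<Rightarrow> nat) \<and>
    uniform_limit (M \<times> M) (\<lambda>j (p, q). d (r j) p q) l sequentially"
proof -
  have nonneg: "0 \<le> d n p q" for n p q
    using Metric_space.nonneg[OF metric] .
  define \<delta> where "\<delta> k = 1 / (real k + 1)" for k :: nat
  have "\<forall>k. \<exists>P. finite P \<and> P \<subseteq> M \<and> (\<forall>q\<in>M. \<exists>p\<in>P. \<rho> p q < \<delta> k)"
    using nets by (simp add: \<delta>_def)
  then obtain P where P: "\<And>k. finite (P k)" "\<And>k. P k \<subseteq> M" "\<And>k q. q \<in> M \<Longrightarrow> \<exists>p\<in>P k. \<rho> p q < \<delta> k"
    by metis
  define S where "S = (\<Union>k. P k) \<times> (\<Union>k. P k)"
  \<comment> \<open>The functions are normalised to be uniformly bounded, as the diagonal argument requires.\<close>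
  define f where "f n z = d n (fst z) (snd z) / (L * \<rho> (fst z) (snd z) + 1)" for n z
  have SM: "fst z \<in> M" "snd z \<in> M" if "z \<in> S" for z
    using that subsetD[OF P(2)] by (auto simp: S_def)
  have pos: "0 < L * \<rho> (fst z) (snd z) + 1" if "z \<in> S" for z
    using nonneg[of 0 "fst z" "snd z"] dom[OF SM[OF that], of 0] by linarith
  have "countable S"
    unfolding S_def using P(1) by (intro countable_SIGMA countable_UN) (auto intro: countable_finite)
  moreover have "norm (f n z) \<le> 1" if "z \<in> S" for n z
    using pos[OF that] nonneg[of n "fst z" "snd z"] dom[OF SM[OF that], of n] by (simp add: f_def field_simps)
  ultimately obtain r :: "nat \<Rightarrow> nat" where r: "strict_mono r"
    "\<And>z. z \<in> S \<Longrightarrow> \<exists>l. (\<lambda>n. f (r n) z) \<longlonglongrightarrow> l"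
    using function_convergent_subsequence[of S f 1] by blast
  have cauchy: "Cauchy (\<lambda>n. d (r n) p q)" if "p \<in> P k" "q \<in> P k" for p q k
  proof -
    have z: "(p, q) \<in> S" using that by (auto simp: S_def)
    obtain l where "(\<lambda>n. f (r n) (p, q)) \<longlonglongrightarrow> l" using r(2)[OF z] by blast
    from tendsto_mult_right[OF this, of "L * \<rho> p q + 1"]
    have "(\<lambda>n. d (r n) p q) \<longlonglongrightarrow> l * (L * \<rho> p q + 1)"
      using pos[OF z] by (simp add: f_def)
    then show ?thesis by (rule LIMSEQ_imp_Cauchy)
  qed
  have "uniformly_Cauchy_on (M \<times> M) (\<lambda>j (p, q). d (r j) p q)"
  proof (rule uniformly_Cauchy_onI)
    fix e :: real assume e: "0 < e"
    \<comment> \<open>Moving each of the two points costs at most \<open>L * \<delta> k \<le> e / 6\<close>, so the values at net points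
      approximate both metrics up to \<open>e / 3\<close>.\<close>
    have "0 < e / (6 * L)" using e L by simp
    then obtain k where "inverse (real (Suc k)) < e / (6 * L)" using reals_Archimedean by blast
    then have k: "\<delta> k < e / (6 * L)" by (simp add: \<delta>_def inverse_eq_divide add.commute)
    have "\<exists>N. \<forall>m\<ge>N. \<forall>n\<ge>N. \<bar>d (r m) (fst z) (snd z) - d (r n) (fst z) (snd z)\<bar> < e / 3" if "z \<in> P k \<times> P k" for z
      using cauchy[of "fst z" k "snd z"] that e unfolding Cauchy_def dist_real_def
      by (metis divide_pos_pos mem_Times_iff zero_less_numeral)
    then obtain N where N: "\<And>z m n. z \<in> P k \<times> P k \<Longrightarrow> N z \<le> m \<Longrightarrow> N z \<le> n \<Longrightarrow>
        \<bar>d (r m) (fst z) (snd z) - d (r n) (fst z) (snd z)\<bar> < e / 3" by metis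
    define K where "K = Max (insert 0 (N ` (P k \<times> P k)))"
    have K: "N z \<le> K" if "z \<in> P k \<times> P k" for z
      unfolding K_def using that P(1)[of k] by (intro Max_ge) auto
    have "dist (d (r m) x y) (d (r n) x y) < e" if xy: "x \<in> M" "y \<in> M" and mn: "K \<le> m" "K \<le> n" for x y m n
    proof -
      obtain p where p: "p \<in> P k" "\<rho> p x < \<delta> k" using P(3)[OF xy(1)] by blast
      obtain q where q: "q \<in> P k" "\<rho> q y < \<delta> k" using P(3)[OF xy(2)] by blast
      have pqM: "p \<in> M" "q \<in> M" using p(1) q(1) P(2) by auto
      have close: "\<bar>d i x y - d i p q\<bar> \<le> e / 3" for i
      proof -
        interpret Metric_space M "d i" by (rule metric)
        have "d i p x \<le> L * (e / (6 * L))" "d i q y \<le> L * (e / (6 * L))"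
          using dom[OF pqM(1) xy(1), of i] dom[OF pqM(2) xy(2), of i] p(2) q(2) k
            mult_left_mono[of "\<rho> p x" "e / (6 * L)" L] mult_left_mono[of "\<rho> q y" "e / (6 * L)" L] L
          by linarith+
        then have "d i p x \<le> e / 6" "d i q y \<le> e / 6" using L by simp_all
        moreover have "d i x y \<le> d i p x + d i p q + d i q y"
          using triangle[OF xy(1) pqM(1) xy(2)] triangle[OF pqM xy(2)] commute[of x p] by linarith
        moreover have "d i p q \<le> d i p x + d i x y + d i q y"
          using triangle[OF pqM(1) xy(1) pqM(2)] triangle[OF xy pqM(2)] commute[of y q] by linarith
        ultimately show ?thesis by linarith
      qed
      have "(p, q) \<in> P k \<times> P k" using p q by simp
      then have "\<bar>d (r m) p q - d (r n) p q\<bar> < e / 3"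
        using N[of "(p, q)" m n] K[of "(p, q)"] mn by simp
      then show ?thesis using close[of "r m"] close[of "r n"] unfolding dist_real_def by linarith
    qed
    then show "\<exists>K. \<forall>z\<in>M \<times> M. \<forall>m\<ge>K. \<forall>n\<ge>K.
        dist (case z of (p, q) \<Rightarrow> d (r m) p q) (case z of (p, q) \<Rightarrow> d (r n) p q) < e"
      by (intro exI[of _ K]) auto
  qed
  from Cauchy_uniformly_convergent[OF this] r(1) show ?thesis
    unfolding uniformly_convergent_on_def by blast
qed

lemma mtopology_eq_of_bilipschitz:
  assumes d: "Metric_space M d" and d': "Metric_space M d'"
    and K: "0 < K" "\<And>p q. p \<in> M \<Longrightarrow> q \<in> M \<Longrightarrow> d' p q \<le> K * d p q"
    and K': "0 < K'" "\<And>p q. p \<in> M \<Longrightarrow> q \<in> M \<Longrightarrow> d p q \<le> K' * d' p q"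
  shows "Metric_space.mtopology M d = Metric_space.mtopology M d'"
proof -
  have imp: "openin (Metric_space.mtopology M d) U"
    if d: "Metric_space M d" and d': "Metric_space M d'" and U: "openin (Metric_space.mtopology M d') U"
      and K: "0 < K" "\<And>p q. p \<in> M \<Longrightarrow> q \<in> M \<Longrightarrow> d' p q \<le> K * d p q" for d d' U and K :: real
    unfolding Metric_space.openin_mtopology[OF d]
  proof (intro conjI allI impI)
    show "U \<subseteq> M" using U by (simp add: Metric_space.openin_mtopology[OF d'])
    fix x assume "x \<in> U"
    then obtain s where s: "0 < s" "Metric_space.mball M d' x s \<subseteq> U"
      using U unfolding Metric_space.openin_mtopology[OF d'] by blast
    have "y \<in> U" if "y \<in> Metric_space.mball M d x (s / K)" for y
    proof -
      have y: "x \<in> M" "y \<in> M" "d x y < s / K" using that by (auto simp: Metric_space.in_mball[OF d])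
      have "d' x y \<le> K * d x y" using K(2) y(1,2) .
      also have "\<dots> < s" using y(3) K(1) by (simp add: field_simps)
      finally have "y \<in> Metric_space.mball M d' x s" using y by (simp add: Metric_space.in_mball[OF d'])
      then show ?thesis using s(2) by (rule subsetD[rotated])
    qed
    then show "\<exists>r>0. Metric_space.mball M d x r \<subseteq> U" using s(1) K(1) by (intro exI[of _ "s / K"]) auto
  qed
  show ?thesis
    unfolding topology_eq using imp[OF d d' _ K] imp[OF d' d _ K'] by blast
qed

text \<open>The sets of points that are close to a given point for the reference distance contain open
neighbourhoods in the product topology, so compactness yields a finite net.\<close>

lemma (in riemannian) ref_dist_finite_nets:
  assumes "compact (UNIV :: 'a set)" "connected (UNIV :: 'a set)" "0 < e"
  shows "\<exists>P. finite P \<and> P \<subseteq> warped_space t0 t1 \<and>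
    (\<forall>q\<in>warped_space t0 t1. \<exists>p\<in>P. ref_dist A g p q < e)"
proof -
  let ?M = "warped_space t0 t1 :: (real \<times> 'a) set"
  have "\<forall>a. \<exists>U. open U \<and> a \<in> U \<and> (\<forall>b\<in>U. riem_dist A g a b < e / 2)"
    using riem_dist_locally_small[of "e / 2"] assms(3) by (meson half_gt_zero)
  then obtain U where U: "\<And>a. open (U a)" "\<And>a. a \<in> U a" "\<And>a b. b \<in> U a \<Longrightarrow> riem_dist A g a b < e / 2"
    by metis
  define N where "N p = ball (fst p) (e / 2) \<times> U (snd p)" for p :: "real \<times> 'a"
  have "compact ?M" unfolding warped_space_def by (intro compact_Times compact_Icc assms(1))
  moreover have "open (N p)" for p unfolding N_def by (intro open_Times open_ball U(1))
  moreover have "?M \<subseteq> \<Union> (N ` ?M)"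
  proof
    fix p assume "p \<in> ?M"
    moreover have "p \<in> N p" using U(2) assms(3) by (simp add: N_def mem_Times_iff)
    ultimately show "p \<in> \<Union> (N ` ?M)" by (rule UN_I)
  qed
  ultimately obtain P where P: "P \<subseteq> ?M" "finite P" "?M \<subseteq> \<Union> (N ` P)"
    by (rule compactE_image)
  have "ref_dist A g p q < e" if "q \<in> N p" for p q
  proof -
    have q: "\<bar>fst q - fst p\<bar> < e / 2" "riem_dist A g (snd p) (snd q) < e / 2"
      using that U(3) by (auto simp: N_def mem_Times_iff dist_real_def abs_minus_commute)
    have "ref_dist A g p q \<le> \<bar>fst q - fst p\<bar> + riem_dist A g (snd p) (snd q)"
      using riem_dist_nonneg[OF assms(2), of "snd p" "snd q"]
        sqrt_sum_squares_le_sum[of "\<bar>fst q - fst p\<bar>" "riem_dist A g (snd p) (snd q)"]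
      by (simp add: ref_dist_def)
    then show ?thesis using q by linarith
  qed
  then have "\<forall>q\<in>?M. \<exists>p\<in>P. ref_dist A g p q < e" using P(3) by (meson UN_E subsetD)
  then show ?thesis using P(1,2) by blast
qed

section \<open>The compactness theorem\<close>

theorem theorem1p1:
  fixes t0 t1 c C :: real
    and A :: "('a::{t2_space, second_countable_topology}, 'e::real_inner) chart set"
    and g :: "('a, 'e) chart \<Rightarrow> 'a \<Rightarrow> 'e \<Rightarrow> 'e \<Rightarrow> real"
    and f :: "nat \<Rightarrow> real \<Rightarrow> real"
    and Q :: "nat \<Rightarrow> real set"
  assumes "t0 < t1"
    and "smooth_atlas A" and "riemannian_metric A g"
    and "compact (UNIV :: 'a set)" and "connected (UNIV :: 'a set)"
    and "0 < c" and "c < 1" and "1 \<le> C"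
    and "\<And>n x. x \<in> {t0..t1} \<Longrightarrow> 0 < f n x"
    and "\<And>n. bounded (f n ` {t0..t1})"
    and "\<And>n. f n \<in> borel_measurable (restrict_space borel {t0..t1})"
    and "\<And>n. Q n \<subseteq> {t0..t1}" and "\<And>n. countable (Q n)" and "\<And>n. {t0..t1} \<subseteq> closure (Q n)"
    and "\<And>n q. q \<in> Q n \<Longrightarrow> f n q \<le> C"
    and "\<And>n x. x \<in> {t0..t1} \<Longrightarrow> c \<le> f n x"
  shows "(\<forall>n. Metric_space (warped_space t0 t1) (warped_dist t0 t1 A g (f n)) \<and>
            (\<forall>p\<in>warped_space t0 t1. \<forall>q\<in>warped_space t0 t1.
               c * ref_dist A g p q \<le> warped_dist t0 t1 A g (f n) p q \<and>
               warped_dist t0 t1 A g (f n) p q \<le> sqrt 2 * C * ref_dist A g p q)) \<and>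
         (\<exists>r d_inf. strict_mono (r :: nat \<Rightarrow> nat) \<and>
            Metric_space (warped_space t0 t1) d_inf \<and>
            uniform_limit (warped_space t0 t1 \<times> warped_space t0 t1)
              (\<lambda>j (p, q). warped_dist t0 t1 A g (f (r j)) p q) (\<lambda>(p, q). d_inf p q) sequentially \<and>
            (\<forall>n. Metric_space.mtopology (warped_space t0 t1) d_inf =
                 Metric_space.mtopology (warped_space t0 t1) (warped_dist t0 t1 A g (f n))) \<and>
            (\<forall>p\<in>warped_space t0 t1. \<forall>q\<in>warped_space t0 t1.
               c * ref_dist A g p q \<le> d_inf p q \<and>
               d_inf p q \<le> sqrt 2 * C * ref_dist A g p q))"
proof -
  let ?M = "warped_space t0 t1 :: (real \<times> 'a) set"
  let ?d = "\<lambda>n. warped_dist t0 t1 A g (f n)"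
  let ?\<rho> = "ref_dist A g"
  let ?L = "sqrt 2 * C"
  have wp: "warped_product A g t0 t1 c C (f n) (Q n)" for n
    by unfold_locales (use assms in auto)
  interpret riemannian A g by unfold_locales (use assms in auto)
  have metric: "Metric_space ?M (?d n)" for n
    using warped_product.Metric_space_warped_dist[OF wp] .
  have lower: "c * ?\<rho> p q \<le> ?d n p q" and upper: "?d n p q \<le> ?L * ?\<rho> p q"
    if "p \<in> ?M" "q \<in> ?M" for n p q
    using warped_product.ref_dist_le_warped_dist[OF wp that] warped_product.warped_dist_le_ref_dist[OF wp that] .
  have L: "0 < ?L" using assms(8) by simp
  obtain r l where r: "strict_mono (r :: nat \<Rightarrow> nat)" and
    unif: "uniform_limit (?M \<times> ?M) (\<lambda>j (p, q). ?d (r j) p q) l sequentially"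
    using uniformly_convergent_subsequence_of_dominated_metrics[of ?M ?d ?L ?\<rho>, OF metric L upper
        ref_dist_finite_nets[OF assms(4,5)]] by blast
  \<comment> \<open>The uniform limit \<open>l\<close> is meaningful on the space only; the value 0 elsewhere keeps the
    extension symmetric and nonnegative.\<close>
  define d_inf where "d_inf p q = (if p \<in> ?M \<and> q \<in> ?M then l (p, q) else 0)" for p q
  have lim: "(\<lambda>j. ?d (r j) p q) \<longlonglongrightarrow> d_inf p q" if "p \<in> ?M" "q \<in> ?M" for p q
    using tendsto_uniform_limitI[OF unif, of "(p, q)"] that by (simp add: d_inf_def)
  have lower': "c * ?\<rho> p q \<le> d_inf p q" and upper': "d_inf p q \<le> ?L * ?\<rho> p q"
    if "p \<in> ?M" "q \<in> ?M" for p q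
    using LIMSEQ_le_const[OF lim[OF that]] LIMSEQ_le_const2[OF lim[OF that]] lower[OF that] upper[OF that]
    by blast+
  have metric': "Metric_space ?M d_inf"
  proof
    show nonneg: "0 \<le> d_inf p q" for p q
    proof (cases "p \<in> ?M \<and> q \<in> ?M")
      case True
      then show ?thesis
        using LIMSEQ_le_const[OF lim, of p q 0] Metric_space.nonneg[OF metric] by blast
    next
      case False
      then show ?thesis by (simp only: d_inf_def if_False order_refl)
    qed
    show "d_inf p q = d_inf q p" for p q
    proof (cases "p \<in> ?M \<and> q \<in> ?M")
      case True
      then have "(\<lambda>j. ?d (r j) p q) \<longlonglongrightarrow> d_inf p q" "(\<lambda>j. ?d (r j) q p) \<longlonglongrightarrow> d_inf q p"
        using lim by simp_all
      moreover have "(\<lambda>j. ?d (r j) q p) = (\<lambda>j. ?d (r j) p q)"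
        by (intro ext Metric_space.commute[OF metric])
      ultimately show ?thesis by (simp add: LIMSEQ_unique)
    qed (auto simp: d_inf_def)
    show "d_inf p s \<le> d_inf p q + d_inf q s" if "p \<in> ?M" "q \<in> ?M" "s \<in> ?M" for p q s
    proof (rule LIMSEQ_le[OF lim[OF that(1,3)] tendsto_add[OF lim[OF that(1,2)] lim[OF that(2,3)]]])
      show "\<exists>N. \<forall>n\<ge>N. ?d (r n) p s \<le> ?d (r n) p q + ?d (r n) q s"
        using Metric_space.triangle[OF metric that] by blast
    qed
    show "d_inf p q = 0 \<longleftrightarrow> p = q" if pq: "p \<in> ?M" "q \<in> ?M" for p q
    proof
      assume "d_inf p q = 0"
      then have "?\<rho> p q \<le> 0" using lower'[OF pq] assms(6) by (simp add: mult_le_0_iff)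
      then have "?L * ?\<rho> p q \<le> 0" using L by (intro mult_nonneg_nonpos) auto
      then have "?d 0 p q \<le> 0" using upper[OF pq, of 0] by linarith
      then have "?d 0 p q = 0" using Metric_space.nonneg[OF metric, of 0 p q] by linarith
      then show "p = q" using Metric_space.zero[OF metric pq] by blast
    next
      assume "p = q"
      then have "?d n p q = 0" for n using Metric_space.zero[OF metric pq] by blast
      then show "d_inf p q = 0" using lim[OF pq] by (simp add: LIMSEQ_const_iff)
    qed
  qed
  have "uniform_limit (?M \<times> ?M) (\<lambda>j (p, q). ?d (r j) p q) (\<lambda>(p, q). d_inf p q) sequentially"
    by (rule uniform_limit_cong'[THEN iffD1, OF _ _ unif]) (auto simp: d_inf_def)
  moreover have "Metric_space.mtopology ?M d_inf = Metric_space.mtopology ?M (?d n)" for n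
  proof (rule mtopology_eq_of_bilipschitz[OF metric' metric])
    show "0 < ?L / c" using L assms(6) by simp
    have chain: "u \<le> ?L / c * v" if "u \<le> ?L * w" "c * w \<le> v" for u v w
    proof -
      have "w \<le> v / c" using that(2) assms(6) by (simp add: field_simps)
      then have "?L * w \<le> ?L * (v / c)" using L by (intro mult_left_mono) auto
      then show ?thesis using that(1) by simp
    qed
    show "?d n p q \<le> ?L / c * d_inf p q" "d_inf p q \<le> ?L / c * ?d n p q" if "p \<in> ?M" "q \<in> ?M" for p q
      using chain[OF upper[OF that] lower'[OF that]] chain[OF upper'[OF that] lower[OF that]] .
  qed (use L assms(6) in simp)
  ultimately show ?thesis
    using metric lower upper r metric' lower' upper' by blast
qed

end
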